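(* Let $k\ge d\ge 5$ and $\nu\ge 0$ be fixed integers. Then \[ f(n,k,d,\nu)\ge \binom{n-k\nu-1}{k-1}+\nu\, EX^{k-2}\left(n-k\nu-1,\mathcal{H}_{k-1}^{d-2}\right)+\nu \] holds for all $n$ (with $n\ge k(\nu+1)$), and \[ f(n,k,d,\nu)\le\binom{n-k\nu-1}{k-1}+(\nu+o(1))\,EX^{k-2}\left(n-k\nu-1,\mathcal{H}_{k-1}^{d-2}\right) \] holds for all sufficiently large $n$, where $o(1)$ denotes a quantity tending to $0$ as $n\to\infty$ with $k,d,\nu$ fixed.
   Context: $[n]=\{1,\dots,n\}$, and $\binom{V}{k}$ is the collection of all $k$-element subsets of a set $V$. A $d$-cluster of $k$-sets is a collection of $d$ different $k$-sets $A_1,\dots,A_d$ with $|A_1\cup\dots\cup A_d|\le 2k$ and $A_1\cap\dots\cap A_d=\emptyset$. A family $\mathcal{F}\subset\binom{[n]}{k}$ is $d$-cluster-free if it contains no $d$-cluster. The matching number $\nu(\mathcal{F})$ is the maximum number of pairwise disjoint sets in $\mathcal{F}$. For $n\ge k(\nu+1)$, $f(n,k,d,\nu)$ is the maximum size of a $d$-cluster-free family $\mathcal{F}\subset\binom{[n]}{k}$ with $\nu(\mathcal{F})\ge\nu+1$. An $r$-multigraph is an $r$-uniform hypergraph in which multiple edges are allowed (each edge is an $r$-set of distinct vertices); an edge of multiplicity $\ell$ is counted $\ell$ times in the number of edges. $\mathcal{H}_{v}^{e}$ is the collection of all $r$-multigraphs on $v$ vertices with $e$ edges (counted with multiplicity).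 An $r$-multigraph is $\mathcal{H}_{v}^{e}$-free if it contains no element of $\mathcal{H}_{v}^{e}$ as a subgraph, i.e. no $v$ vertices span $e$ or more edges counted with multiplicity. $EX^{r}(n,\mathcal{H}_{v}^{e})$ is the maximum number of edges (counted with multiplicity) in an $n$-vertex $\mathcal{H}_{v}^{e}$-free $r$-multigraph. In the claim, $r=k-2$. *)

theory Defs
  imports Complex_Main "HOL-Library.Multiset" "HOL-Library.Disjoint_Sets" "HOL-Library.Ramsey"
begin

definition d_cluster :: "nat \<Rightarrow> nat \<Rightarrow> 'a set set \<Rightarrow> bool" where
  "d_cluster k d C \<longleftrightarrow>
     finite C \<and> card C = d \<and> (\<forall>A\<in>C. finite A \<and> card A = k) \<and>
     card (\<Union>C) \<le> 2 * k \<and> \<Inter>C = {}"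

definition cluster_free :: "nat \<Rightarrow> nat \<Rightarrow> 'a set set \<Rightarrow> bool" where
  "cluster_free k d F \<longleftrightarrow> \<not> (\<exists>C. C \<subseteq> F \<and> d_cluster k d C)"

definition matching_number :: "'a set set \<Rightarrow> nat" where
  "matching_number F = Max {card M | M. M \<subseteq> F \<and> disjoint M}"

text \<open>The families over which the maximum is taken exist when \<open>n \<ge> k * (\<nu> + 1)\<close> and
  \<open>k \<ge> 1\<close>, \<open>d \<ge> 3\<close>: take \<open>\<nu> + 1\<close> pairwise disjoint \<open>k\<close>-sets.\<close>

definition max_cluster_free :: "nat \<Rightarrow> nat \<Rightarrow> nat \<Rightarrow> nat \<Rightarrow> nat" where
  "max_cluster_free n k d \<nu> =
     Max {card F | F. F \<subseteq> nsets {1..n} k \<and> cluster_free k d F \<and> matching_number F \<ge> \<nu> + 1}"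

text \<open>A multigraph is a pair of a vertex set and a multiset of edges.\<close>

type_synonym 'a multigraph = "'a set \<times> 'a set multiset"

definition r_multigraph :: "nat \<Rightarrow> 'a multigraph \<Rightarrow> bool" where
  "r_multigraph r = (\<lambda>(V, E). finite V \<and> (\<forall>e\<in>#E. e \<subseteq> V \<and> card e = r))"

definition sub_multigraph :: "'a multigraph \<Rightarrow> 'a multigraph \<Rightarrow> bool" where
  "sub_multigraph = (\<lambda>(W, M) (V, E). W \<subseteq> V \<and> M \<subseteq># E)"

definition H_family :: "nat \<Rightarrow> nat \<Rightarrow> nat \<Rightarrow> 'a multigraph set" where
  "H_family r v e = {(W, M). r_multigraph r (W, M) \<and> card W = v \<and> size M = e}"

text \<open>\<open>H_family r v e\<close> is closed under renaming of vertices within the type, so no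
  isomorphism is needed in the definition of containment.\<close>

definition H_free :: "nat \<Rightarrow> nat \<Rightarrow> nat \<Rightarrow> 'a multigraph \<Rightarrow> bool" where
  "H_free r v e G \<longleftrightarrow> \<not> (\<exists>H \<in> H_family r v e. sub_multigraph H G)"

text \<open>For \<open>r \<le> v \<le> n\<close> and \<open>e \<ge> 1\<close>, every edge of an \<open>H_free r v e\<close> multigraph on \<open>n\<close> vertices
  lies in some \<open>v\<close>-set of vertices and so has multiplicity less than \<open>e\<close>; the set below is
  then finite and nonempty. For \<open>r \<le> n < v\<close> it is infinite and \<open>Max\<close> is meaningless.\<close>

definition EX_multi :: "nat \<Rightarrow> nat \<Rightarrow> nat \<Rightarrow> nat \<Rightarrow> nat" where
  "EX_multi r n v e =
     Max {size E | E. r_multigraph r ({1..n}, E) \<and> H_free r v e ({1..n}, E)}"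

end

(*
For the lower bound, add to the star of a vertex x some nu disjoint k-sets B and, for each edge e of
an extremal multigraph with multiplicity w(e), the sets {x, b} + e for w(e) points b of each B.

For the upper bound, say that x is an own point of A if A - x lies in no other member of F. Apart from
O(n^(k-2)) irregular sets, the kernels in A are closed under intersection, and then a partition of A
into d - 1 parts yields a cluster unless A has at least three own points, or exactly one own point c and
every A - x with x distinct from c is a kernel. Pairs (A, x) with x an own point inject into the
(k-1)-sets, so if F is as large as a star up to O(n^(k-2)), almost every (k-1)-set T is A - c for a
unique such A. Two adjacent T have the same c, since otherwise there is a cluster, so nearly all T have
the same centre x. The multiplicities w(e) of sets {x, b} + e with b in a given B avoiding x then form a
multigraph that violates the sparsity condition only on sets T with T + x not in F, of which there are
O(n^(k-2)), and averaging over subsets of constant size bounds it by (1 + o(1)) EX. A double count shows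
that the members avoiding x are outnumbered by the sets missing from the star, up to O(n^(k-3)).
*)
theory Submission
  imports Defs
begin

section \<open>Kernels and clusters\<close>

text \<open>The obstacle is one of orders. Stability finds the centre only up to O(n^(k-2)) sets,
  which is exactly the order of the EX term, so a second pass must gain a factor n. It does so
  without improving either bound: the members avoiding x and the sets missing from the star are
  compared with each other, and in the final count they cancel up to O(n^(k-3)). That remainder can
  be charged to o(1) EX because EX itself has order n^(k-2): for d at least 5, k - 1 vertices may
  span two edges, which admits the complete (k-2)-partite hypergraph. Three own points are a
  surplus: in a family about as large as a star, a member has on average only about one (k-1)-set to
  claim, so regular members with three are O(n^(k-2)) in number. In a partition cluster, a part with
  several points needs a kernel to be cut out of A, while a one-point part {x} needs only a second
  member through A - x. Hence all own points must go into the one large part. Of the matching, only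
  nu disjoint members avoiding x are used; the star members that meet their union at least twice are
  O(n^(k-3)).\<close>

lemma choose_le_power: "n choose j \<le> n ^ j"
proof (cases "j \<le> n")
  case True
  then show ?thesis by (rule binomial_le_pow)
qed (simp add: binomial_eq_0)

lemma card_nsets_le: "finite V \<Longrightarrow> card (nsets V j) \<le> card V ^ j"
  by (simp add: choose_le_power)

lemma card_supersets_le:
  assumes "finite V" "L \<subseteq> V"
  shows "card {A \<in> nsets V k. L \<subseteq> A} \<le> card V ^ (k - card L)"
proof -
  have fL: "finite L" using assms finite_subset by blast
  have "card {A \<in> nsets V k. L \<subseteq> A} \<le> card (nsets V (k - card L))"
  proof (rule card_inj_on_le[where f = "\<lambda>A. A - L"])
    show "inj_on (\<lambda>A. A - L) {A \<in> nsets V k. L \<subseteq> A}" by (auto simp: inj_on_def)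
    show "(\<lambda>A. A - L) ` {A \<in> nsets V k. L \<subseteq> A} \<subseteq> nsets V (k - card L)"
      using fL by (auto simp: nsets_def card_Diff_subset)
  qed (simp add: assms finite_imp_finite_nsets)
  also have "\<dots> \<le> card V ^ (k - card L)" by (rule card_nsets_le[OF assms(1)])
  finally show ?thesis .
qed

lemma card_containing_le:
  assumes "finite V" "finite \<L>" "\<L> \<subseteq> nsets V l" "\<A> \<subseteq> {A \<in> nsets V k. \<exists>L\<in>\<L>. L \<subseteq> A}"
  shows "card \<A> \<le> card \<L> * card V ^ (k - l)"
proof -
  have fin: "finite (nsets V k)" by (simp add: assms(1) finite_imp_finite_nsets)
  have "card \<A> \<le> card (\<Union>L\<in>\<L>. {A \<in> nsets V k. L \<subseteq> A})"
    using assms(4) by (intro card_mono finite_UN_I assms(2)) (auto simp: fin)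
  also have "\<dots> \<le> (\<Sum>L\<in>\<L>. card {A \<in> nsets V k. L \<subseteq> A})"
    by (rule card_UN_le[OF assms(2)])
  also have "\<dots> \<le> (\<Sum>L\<in>\<L>. card V ^ (k - l))"
  proof (rule sum_mono)
    fix L assume "L \<in> \<L>"
    then have "L \<subseteq> V" "card L = l" using assms(3) by (auto simp: nsets_def)
    then show "card {A \<in> nsets V k. L \<subseteq> A} \<le> card V ^ (k - l)"
      using card_supersets_le[OF assms(1)] by metis
  qed
  finally show ?thesis by simp
qed

section \<open>Kernels, covers and the irregular members\<close>

locale cluster_free_family =
  fixes V :: "'a set" and F :: "'a set set" and k d :: nat
  assumes finV: "finite V" and F_sub: "F \<subseteq> nsets V k" and cf: "cluster_free k d F"
    and d5: "5 \<le> d" and dk: "d \<le> k"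
begin

lemma F_D: "A \<in> F \<Longrightarrow> A \<subseteq> V \<and> finite A \<and> card A = k"
  using F_sub by (auto simp: nsets_def)

lemma finF: "finite F"
  using F_sub finV finite_imp_finite_nsets finite_subset by blast

lemma no_cluster:
  assumes "C \<subseteq> F" "card C = d" "card (\<Union>C) \<le> 2 * k" "\<Inter>C = {}"
  shows False
proof -
  have "finite C" using assms(1) finF finite_subset by blast
  then have "d_cluster k d C" using assms F_D unfolding d_cluster_def by blast
  then show False using cf assms(1) unfolding cluster_free_def by blast
qed

text \<open>A kernel is a set whose link is not covered by \<open>k\<close> points; it serves as the core of a large
  sunflower. The sets \<open>A \<in> F\<close> whose kernels are not closed under intersection contain two points of
  the cover of some non-kernel below \<open>A\<close>, which makes them few.\<close>

definition kernel :: "'a set \<Rightarrow> bool" where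
  "kernel K \<longleftrightarrow> (\<forall>S. finite S \<and> card S \<le> k \<and> S \<inter> K = {} \<longrightarrow> (\<exists>A\<in>F. K \<subseteq> A \<and> A \<inter> S = {}))"

text \<open>A chosen witness that \<open>K\<close> is not a kernel. The empty default for kernels
  makes the bounds of \<open>cover_basic\<close> unconditional.\<close>

definition cover :: "'a set \<Rightarrow> 'a set" where
  "cover K = (if kernel K then {} else
     SOME S. finite S \<and> card S \<le> k \<and> S \<inter> K = {} \<and> (\<forall>A\<in>F. K \<subseteq> A \<longrightarrow> A \<inter> S \<noteq> {}))"

lemma cover_nonkernel:
  assumes "\<not> kernel K"
  shows "finite (cover K) \<and> card (cover K) \<le> k \<and> cover K \<inter> K = {}
    \<and> (\<forall>A\<in>F. K \<subseteq> A \<longrightarrow> A \<inter> cover K \<noteq> {})"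
proof -
  have "\<exists>S. finite S \<and> card S \<le> k \<and> S \<inter> K = {} \<and> (\<forall>A\<in>F. K \<subseteq> A \<longrightarrow> A \<inter> S \<noteq> {})"
    using assms unfolding kernel_def by (auto simp: Ball_def Bex_def)
  from someI_ex[OF this] show ?thesis using assms unfolding cover_def by auto
qed

lemma cover_basic: "finite (cover K) \<and> card (cover K) \<le> k \<and> cover K \<inter> K = {}"
  using cover_nonkernel[of K] by (cases "kernel K") (auto simp: cover_def)

text \<open>The first clause lets removals of parts be combined. The second gives a start where
  single points cannot be removed: two points \<open>x\<close>, \<open>y\<close> for which neither
  \<open>A - {x}\<close> nor \<open>A - {y}\<close> is a kernel can still be removed
  together.\<close>

definition regular :: "'a set \<Rightarrow> bool" where
  "regular A \<longleftrightarrow>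
     (\<forall>K1 K2. kernel K1 \<and> kernel K2 \<and> K1 \<subseteq> A \<and> K2 \<subseteq> A \<longrightarrow> kernel (K1 \<inter> K2)) \<and>
     (\<forall>x\<in>A. \<forall>y\<in>A. x \<noteq> y \<longrightarrow> kernel (A - {x, y}) \<or> kernel (A - {x}) \<or> kernel (A - {y}))"

text \<open>If \<open>L = K1 \<inter> K2\<close> is not a kernel, its cover must meet both
  \<open>K1\<close> and \<open>K2\<close>, since otherwise a member through one of them would escape
  it; the two points lie outside \<open>L\<close>, hence differ. If the pair clause fails, the cover
  of \<open>L = A - {x, y}\<close> can meet \<open>A\<close> only in \<open>x\<close> or
  \<open>y\<close>; adding that point \<open>u\<close> to \<open>L\<close> gives another non-kernel,
  whose cover must contain the remaining point.\<close>

lemma irregular_witness: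
  assumes "A \<in> F" "\<not> regular A"
  shows "\<exists>L u v. L \<subseteq> A \<and> u \<in> A \<and> v \<in> A \<and> u \<noteq> v \<and> u \<notin> L \<and> v \<notin> L \<and>
    u \<in> cover L \<and> v \<in> cover L \<union> cover (insert u L)"
proof -
  consider (1) K1 K2 where "kernel K1" "kernel K2" "K1 \<subseteq> A" "K2 \<subseteq> A" "\<not> kernel (K1 \<inter> K2)"
    | (2) x y where "x \<in> A" "y \<in> A" "x \<noteq> y" "\<not> kernel (A - {x, y})" "\<not> kernel (A - {x})" "\<not> kernel (A - {y})"
    using assms(2) unfolding regular_def by blast
  then show ?thesis
  proof cases
    case 1
    define L where "L = K1 \<inter> K2"
    note c = cover_nonkernel[of L, unfolded L_def, OF 1(5), folded L_def]
    have "cover L \<inter> K1 \<noteq> {}" "cover L \<inter> K2 \<noteq> {}"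
      using c 1(1,2) unfolding kernel_def L_def by (metis inf_le1 inf_le2 subset_trans)+
    then obtain u v where "u \<in> cover L" "u \<in> K1" "v \<in> cover L" "v \<in> K2" by blast
    moreover from this have "u \<notin> L" "v \<notin> L" using c by auto
    moreover from this have "u \<noteq> v" using calculation by (auto simp: L_def)
    moreover have "L \<subseteq> A" using 1(3) by (auto simp: L_def)
    ultimately show ?thesis using 1(3,4) by (intro exI[of _ L] exI[of _ u] exI[of _ v]) auto
  next
    case 2
    define L where "L = A - {x, y}"
    note c = cover_nonkernel[of L, unfolded L_def, OF 2(4), folded L_def]
    have "L \<subseteq> A" "A \<inter> cover L \<subseteq> {x, y}" using c by (auto simp: L_def)
    with c assms(1) consider "x \<in> cover L" | "y \<in> cover L" by blast
    then show ?thesis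
    proof cases
      case 1
      have e: "insert x L = A - {y}" using 2 by (auto simp: L_def)
      have "y \<in> cover (insert x L)" using cover_nonkernel[OF 2(6)] assms(1) unfolding e by blast
      then show ?thesis using 1 2 unfolding L_def
        by (intro exI[of _ "A - {x,y}"] exI[of _ x] exI[of _ y]) auto
    next
      case b: 2
      have e: "insert y L = A - {x}" using 2 by (auto simp: L_def)
      have "x \<in> cover (insert y L)" using cover_nonkernel[OF 2(5)] assms(1) unfolding e by blast
      then show ?thesis using b 2 unfolding L_def
        by (intro exI[of _ "A - {x,y}"] exI[of _ y] exI[of _ x]) auto
    qed
  qed
qed

text \<open>For given \<open>L\<close>, the points \<open>u\<close>, \<open>v\<close> of
  \<open>irregular_witness\<close> range over at most \<open>k * (2 * k)\<close> pairs, so two of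
  the \<open>k\<close> points of an irregular member cost only a constant factor. The third factor
  \<open>k\<close> pays for the possible sizes of \<open>L\<close>.\<close>

lemma card_irregular: "card {A\<in>F. \<not> regular A} \<le> 2 * k ^ 3 * card V ^ (k - 2)"
proof -
  define pairs where "pairs L = (SIGMA u:cover L. cover L \<union> cover (insert u L))" for L
  define \<M> where "\<M> l = {M \<in> nsets V (l + 2). \<exists>L\<in>nsets V l. \<exists>p\<in>pairs L. M = L \<union> {fst p, snd p}}" for l
  define I where "I l = {A \<in> nsets V k. \<exists>M\<in>\<M> l. M \<subseteq> A}" for l
  have fp: "finite (pairs L)" and cp: "card (pairs L) \<le> 2 * k ^ 2" for L
  proof -
    show "finite (pairs L)" unfolding pairs_def using cover_basic by blast
    have "card (pairs L) = (\<Sum>u\<in>cover L. card (cover L \<union> cover (insert u L)))"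
      unfolding pairs_def using cover_basic by (intro card_SigmaI) auto
    also have "\<dots> \<le> (\<Sum>u\<in>cover L. 2 * k)"
    proof (rule sum_mono)
      fix u
      have "card (cover L \<union> cover (insert u L)) \<le> card (cover L) + card (cover (insert u L))"
        by (rule card_Un_le)
      also have "\<dots> \<le> k + k" using cover_basic by (intro add_mono) auto
      finally show "card (cover L \<union> cover (insert u L)) \<le> 2 * k" by simp
    qed
    also have "\<dots> \<le> k * (2 * k)" using cover_basic[of L] by simp
    finally show "card (pairs L) \<le> 2 * k ^ 2" by (simp add: power2_eq_square algebra_simps)
  qed
  have finM: "finite (\<M> l)" for l
    unfolding \<M>_def using finite_imp_finite_nsets[OF finV] by simp
  have cM: "card (\<M> l) \<le> card V ^ l * (2 * k ^ 2)" for l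
  proof -
    have "\<M> l \<subseteq> (\<Union>L\<in>nsets V l. (\<lambda>p. L \<union> {fst p, snd p}) ` pairs L)" by (auto simp: \<M>_def)
    then have "card (\<M> l) \<le> card (\<Union>L\<in>nsets V l. (\<lambda>p. L \<union> {fst p, snd p}) ` pairs L)"
      by (intro card_mono finite_UN_I finite_imp_finite_nsets finV finite_imageI fp)
    also have "\<dots> \<le> (\<Sum>L\<in>nsets V l. card ((\<lambda>p. L \<union> {fst p, snd p}) ` pairs L))"
      by (intro card_UN_le finite_imp_finite_nsets finV)
    also have "\<dots> \<le> (\<Sum>L\<in>nsets V l. 2 * k ^ 2)"
      by (intro sum_mono order.trans[OF card_image_le[OF fp] cp])
    also have "\<dots> = card (nsets V l) * (2 * k ^ 2)" by simp
    also have "\<dots> \<le> card V ^ l * (2 * k ^ 2)"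
      by (rule mult_right_mono[OF card_nsets_le[OF finV]]) simp
    finally show ?thesis .
  qed
  have sub: "{A\<in>F. \<not> regular A} \<subseteq> (\<Union>l\<in>{..k-2}. I l)"
  proof
    fix A assume "A \<in> {A\<in>F. \<not> regular A}"
    then have A: "A \<in> F" "\<not> regular A" by auto
    from irregular_witness[OF A] obtain L u v where
      w: "L \<subseteq> A" "u \<in> A" "v \<in> A" "u \<noteq> v" "u \<notin> L" "v \<notin> L"
        "u \<in> cover L" "v \<in> cover L \<union> cover (insert u L)" by blast
    have fA: "finite A" "card A = k" "A \<subseteq> V" using F_D[OF A(1)] by auto
    have fL: "finite L" using w(1) fA finite_subset by blast
    have c2: "card (L \<union> {u, v}) = card L + 2" using w fL by simp
    have "card (L \<union> {u, v}) \<le> card A" using w fA by (intro card_mono) auto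
    then have l: "card L \<le> k - 2" using c2 fA(2) by simp
    have M: "L \<union> {u, v} \<in> nsets V (card L + 2)" "L \<in> nsets V (card L)"
      using w fA fL c2 by (auto simp: nsets_def)
    have "(u, v) \<in> pairs L" using w unfolding pairs_def by blast
    then have "L \<union> {u, v} \<in> \<M> (card L)" unfolding \<M>_def
      using M by (auto intro!: bexI[of _ L] bexI[of _ "(u, v)"])
    moreover have "L \<union> {u, v} \<subseteq> A" using w by auto
    ultimately have "A \<in> I (card L)" using A(1) F_sub
      unfolding I_def by (intro CollectI conjI bexI[of _ "L \<union> {u, v}"]) auto
    then show "A \<in> (\<Union>l\<in>{..k-2}. I l)" using l by blast
  qed
  have finI: "finite (I l)" for l unfolding I_def using finite_imp_finite_nsets[OF finV] by simp
  have "card {A\<in>F. \<not> regular A} \<le> card (\<Union>l\<in>{..k-2}. I l)"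
    by (rule card_mono[OF _ sub]) (simp add: finI)
  also have "\<dots> \<le> (\<Sum>l\<in>{..k-2}. card (I l))" by (rule card_UN_le) simp
  also have "\<dots> \<le> (\<Sum>l\<in>{..k-2}. 2 * k ^ 2 * card V ^ (k - 2))"
  proof (rule sum_mono)
    fix l assume l: "l \<in> {..k-2}"
    have "card (I l) \<le> card (\<M> l) * card V ^ (k - (l + 2))"
      by (rule card_containing_le[OF finV finM]) (auto simp: \<M>_def I_def)
    also have "\<dots> \<le> (card V ^ l * (2 * k ^ 2)) * card V ^ (k - (l + 2))"
      by (rule mult_right_mono[OF cM]) simp
    also have "\<dots> = 2 * k ^ 2 * (card V ^ l * card V ^ (k - (l + 2)))" by (simp only: mult_ac)
    also have "card V ^ l * card V ^ (k - (l + 2)) = card V ^ (k - 2)"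
      using l d5 dk by (simp flip: power_add)
    finally show "card (I l) \<le> 2 * k ^ 2 * card V ^ (k - 2)" .
  qed
  also have "\<dots> = (k - 1) * (2 * k ^ 2 * card V ^ (k - 2))" using d5 dk by (simp add: Suc_diff_Suc numeral_2_eq_2)
  also have "\<dots> \<le> k * (2 * k ^ 2 * card V ^ (k - 2))" by (rule mult_right_mono) simp_all
  also have "\<dots> = 2 * k ^ 3 * card V ^ (k - 2)" by (simp add: power3_eq_cube power2_eq_square)
  finally show ?thesis .
qed

text \<open>Choosing \<open>P\<close> itself as the set to avoid fixes the trace on \<open>A\<close>
  exactly.\<close>

lemma kernel_avoid:
  assumes "kernel (A - P)" "P \<subseteq> A" "A \<in> F"
  shows "\<exists>B\<in>F. B \<inter> A = A - P"
proof -
  have fA: "finite A" "card A = k" using F_D[OF assms(3)] by auto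
  have "finite P" "card P \<le> k" using fA assms(2) card_mono finite_subset by metis+
  then obtain B where "B \<in> F" "A - P \<subseteq> B" "B \<inter> P = {}"
    using assms(1) unfolding kernel_def by (metis Diff_disjoint inf_commute)
  then show ?thesis using assms(2) by (intro bexI[of _ B]) auto
qed

text \<open>Removing the sets of a partition one at a time from \<open>A\<close> leaves traces whose
  intersection is empty, while the union grows by no more than the sizes of the parts.\<close>

lemma partition_cluster:
  assumes A: "A \<in> F" and E: "E \<subseteq> F" "A \<notin> E"
    and \<P>: "disjoint \<P>" "{} \<notin> \<P>" "\<Union>\<P> \<subseteq> A" "finite \<P>"
    and B: "\<And>P. P \<in> \<P> \<Longrightarrow> \<exists>B\<in>F. B \<inter> A = A - P"
    and ndE: "\<And>P B. P \<in> \<P> \<Longrightarrow> B \<in> E \<Longrightarrow> B \<inter> A \<noteq> A - P"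
    and cards: "card \<P> + card E + 1 = d" "card (A \<union> \<Union>E) + card (\<Union>\<P>) \<le> 2 * k"
    and int: "A \<inter> \<Inter>E \<subseteq> \<Union>\<P>"
  shows False
proof -
  have "\<forall>P\<in>\<P>. \<exists>B. B \<in> F \<and> B \<inter> A = A - P" using B by blast
  from bchoice[OF this] obtain f where f: "\<And>P. P \<in> \<P> \<Longrightarrow> f P \<in> F" "\<And>P. P \<in> \<P> \<Longrightarrow> f P \<inter> A = A - P"
    by blast
  have fE: "finite E" using E(1) finF finite_subset by blast
  have fA: "finite A" "card A = k" using F_D[OF A] by auto
  have sub: "P \<subseteq> A" if "P \<in> \<P>" for P using that \<P>(3) by blast
  have injf: "inj_on f \<P>"
  proof (rule inj_onI)
    fix P Q assume "P \<in> \<P>" "Q \<in> \<P>" "f P = f Q"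
    then have "A - P = A - Q" using f(2) by metis
    then show "P = Q" using sub[OF \<open>P \<in> \<P>\<close>] sub[OF \<open>Q \<in> \<P>\<close>] by blast
  qed
  define C where "C = insert A E \<union> f ` \<P>"
  have nA: "A \<notin> f ` \<P>"
  proof
    assume "A \<in> f ` \<P>"
    then obtain P where P: "P \<in> \<P>" "A = f P" by blast
    then have "A = A - P" using f(2)[OF P(1)] by simp
    then have "P = {}" using sub[OF P(1)] by blast
    then show False using P(1) \<P>(2) by simp
  qed
  have dE: "insert A E \<inter> f ` \<P> = {}" using nA ndE f(2) by blast
  have "card C = card (insert A E) + card (f ` \<P>)"
    unfolding C_def using fE \<P>(4) dE by (intro card_Un_disjoint) auto
  also have "\<dots> = d" using cards(1) E(2) fE card_image[OF injf] by simp
  finally have cC: "card C = d" .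
  have CF: "C \<subseteq> F" using A E f unfolding C_def by auto
  have fin: "finite (\<Union>\<P>)" "finite (A \<union> \<Union>E)"
    using fA \<P>(3) fE F_D E(1) finite_subset by (blast, metis finite_Un finite_Union subsetD)
  have fC: "finite (\<Union>P\<in>\<P>. f P - A)" using f(1) F_D \<P>(4) by auto
  have "\<Union>C = (A \<union> \<Union>E) \<union> (\<Union>P\<in>\<P>. f P - A)" unfolding C_def by auto
  then have "card (\<Union>C) \<le> card (A \<union> \<Union>E) + card (\<Union>P\<in>\<P>. f P - A)" by (simp add: card_Un_le)
  \<comment> \<open>The trace of \<open>f P\<close> on \<open>A\<close> has
    \<open>k - card P\<close> points, so \<open>f P\<close> adds exactly \<open>card P\<close>
    points outside \<open>A\<close>; over disjoint parts this totals the size of their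
    union.\<close>
  also have "card (\<Union>P\<in>\<P>. f P - A) \<le> (\<Sum>P\<in>\<P>. card (f P - A))" by (rule card_UN_le[OF \<P>(4)])
  also have "\<dots> = (\<Sum>P\<in>\<P>. card P)"
  proof (rule sum.cong[OF refl])
    fix P assume P: "P \<in> \<P>"
    have fin: "finite (f P)" "card (f P) = k" "finite P" using F_D[OF f(1)[OF P]] sub[OF P] fA finite_subset by auto
    have "card (f P - A) = card (f P) - card (f P \<inter> A)" using fin by (simp add: card_Diff_subset_Int)
    also have "\<dots> = k - (k - card P)" using f(2)[OF P] fin sub[OF P] fA by (simp add: card_Diff_subset)
    also have "\<dots> = card P" using card_mono[OF fA(1) sub[OF P]] fA(2) by simp
    finally show "card (f P - A) = card P" .
  qed
  also have "\<dots> = card (\<Union>\<P>)"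
    using \<P>(1) finite_subset[OF sub fA(1)]
    by (intro card_Union_disjoint[symmetric]) (auto simp: disjoint_def pairwise_def disjnt_def)
  finally have cU: "card (\<Union>C) \<le> 2 * k" using cards(2) by simp
  have "\<Inter>C = {}"
  proof (rule ccontr)
    assume "\<Inter>C \<noteq> {}"
    then obtain z where z: "z \<in> \<Inter>C" by blast
    then have "z \<in> A" "z \<in> \<Inter>E" by (auto simp: C_def)
    then obtain P where P: "P \<in> \<P>" "z \<in> P" using int by blast
    have "z \<in> f P" using z P by (auto simp: C_def)
    then show False using f(2)[OF P(1)] P \<open>z \<in> A\<close> by blast
  qed
  from no_cluster[OF CF cC cU this] show False .
qed

section \<open>Own points of a regular member\<close>

definition own :: "'a set \<Rightarrow> 'a set" where
  "own A = {x\<in>A. \<forall>B\<in>F. A - {x} \<subseteq> B \<longrightarrow> B = A}"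

lemma sum_card_own: "(\<Sum>A\<in>F. card (own A)) \<le> card V choose (k - 1)"
proof -
  have fo: "finite (own A)" if "A \<in> F" for A using F_D[OF that] by (auto simp: own_def)
  have "(\<Sum>A\<in>F. card (own A)) = card (SIGMA A:F. own A)"
    using finF fo by (intro card_SigmaI[symmetric]) auto
  also have "\<dots> \<le> card (nsets V (k - 1))"
  proof (rule card_inj_on_le[where f = "\<lambda>p. fst p - {snd p}"])
    show "inj_on (\<lambda>p. fst p - {snd p}) (SIGMA A:F. own A)"
    proof (rule inj_onI)
      fix p q assume p: "p \<in> (SIGMA A:F. own A)" and q: "q \<in> (SIGMA A:F. own A)"
        and eq: "fst p - {snd p} = fst q - {snd q}"
      have "fst p - {snd p} \<subseteq> fst q" using eq by auto
      then have "fst p = fst q" using p q unfolding own_def by (cases p, cases q) auto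
      moreover have "snd p = snd q" using p q eq calculation unfolding own_def by auto
      ultimately show "p = q" by (simp add: prod_eq_iff)
    qed
    show "(\<lambda>p. fst p - {snd p}) ` (SIGMA A:F. own A) \<subseteq> nsets V (k - 1)"
    proof (intro image_subsetI)
      fix p assume "p \<in> (SIGMA A:F. own A)"
      then show "fst p - {snd p} \<in> nsets V (k - 1)"
        using F_D[of "fst p"] by (auto simp: nsets_def own_def)
    qed
  qed (simp add: finV finite_imp_finite_nsets)
  finally show ?thesis by (simp add: )
qed

lemma kernel_Diff_UN:
  assumes "regular A" "finite I" "I \<noteq> {}" "\<And>i. i \<in> I \<Longrightarrow> kernel (A - g i)"
  shows "kernel (A - (\<Union>i\<in>I. g i))"
  using assms(2,3,4)
proof (induction I rule: finite_ne_induct)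
  case (insert i I)
  have "A - (\<Union>j\<in>insert i I. g j) = (A - g i) \<inter> (A - (\<Union>j\<in>I. g j))" by auto
  moreover have "kernel (A - g i)" "kernel (A - (\<Union>j\<in>I. g j))" using insert by auto
  ultimately show ?case using assms(1) unfolding regular_def by (metis Diff_subset)
qed simp

lemma kernel_Diff_singles:
  assumes "A \<in> F" "regular A" "P \<subseteq> A" "P \<noteq> {}" "\<And>x. x \<in> P \<Longrightarrow> kernel (A - {x})"
  shows "kernel (A - P)"
proof -
  have "finite P" using F_D[OF assms(1)] assms(3) finite_subset by blast
  from kernel_Diff_UN[OF assms(2) this assms(4), of "\<lambda>x. {x}"] assms(5) show ?thesis by simp
qed

text \<open>Every other point \<open>z\<close> of \<open>P\<close> is removed alone if
  \<open>A - {z}\<close> is a kernel, and together with \<open>x\<close> otherwise; \<open>x\<close>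
  is paired with \<open>y\<close>. All these removals stay inside \<open>P\<close> and exhaust it,
  so intersecting the resulting kernels gives \<open>A - P\<close>.\<close>

lemma kernel_Diff_pairs:
  assumes "A \<in> F" "regular A" "P \<subseteq> A" "x \<in> P" "y \<in> P" "x \<noteq> y"
    "\<not> kernel (A - {x})" "\<not> kernel (A - {y})"
  shows "kernel (A - P)"
proof -
  have fP: "finite P" using F_D[OF assms(1)] assms(3) finite_subset by blast
  have *: "kernel (A - {u, v})" if "u \<in> A" "v \<in> A" "u \<noteq> v" "\<not> kernel (A - {u})" "\<not> kernel (A - {v})" for u v
    using assms(2) that unfolding regular_def by blast
  define g where "g z = (if kernel (A - {z}) then {z} else if z = x then {x, y} else {x, z})" for z
  have "kernel (A - (\<Union>z\<in>P. g z))"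
  proof (rule kernel_Diff_UN[OF assms(2) fP])
    show "P \<noteq> {}" using assms by auto
    fix z assume "z \<in> P"
    then show "kernel (A - g z)" using assms * unfolding g_def by (auto simp: subset_iff)
  qed
  moreover have "(\<Union>z\<in>P. g z) = P"
  proof
    show "(\<Union>z\<in>P. g z) \<subseteq> P" using assms unfolding g_def by (auto split: if_splits)
    show "P \<subseteq> (\<Union>z\<in>P. g z)" unfolding g_def by auto
  qed
  ultimately show ?thesis by simp
qed

text \<open>The substitute for \<open>kernel_avoid\<close> when the part is a single point: a second
  member through \<open>A - {x}\<close> cannot contain \<open>x\<close>, as it would then include
  \<open>A\<close> and have the same size.\<close>

lemma not_own_avoid:
  assumes "A \<in> F" "x \<in> A" "x \<notin> own A"
  shows "\<exists>B\<in>F. B \<inter> A = A - {x}"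
proof -
  obtain B where B: "B \<in> F" "A - {x} \<subseteq> B" "B \<noteq> A" using assms unfolding own_def by blast
  have "x \<notin> B"
  proof
    assume "x \<in> B"
    then have "A \<subseteq> B" using B by auto
    then have "A = B" using F_D[OF assms(1)] F_D[OF B(1)] card_subset_eq by metis
    then show False using B by simp
  qed
  then show ?thesis using B by (intro bexI[of _ B]) auto
qed

lemma own_not_kernel:
  assumes "A \<in> F" "x \<in> own A" shows "\<not> kernel (A - {x})"
proof
  assume "kernel (A - {x})"
  then obtain B where "B \<in> F" "B \<inter> A = A - {x}"
    using kernel_avoid[of A "{x}"] assms unfolding own_def by auto
  then show False using assms unfolding own_def by blast
qed

text \<open>\<open>A\<close> is partitioned into \<open>Q\<close> and the \<open>d - 2\<close>
  single points outside \<open>Q\<close>. These \<open>d - 1\<close> parts and \<open>A\<close>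
  itself make \<open>d\<close> members with union at most \<open>k + k\<close>. The single points
  are not own points, so \<open>not_own_avoid\<close> serves them and only \<open>Q\<close> needs a
  kernel.\<close>

lemma big_part_cluster:
  assumes A: "A \<in> F" and Q: "Q \<subseteq> A" "card Q = k - d + 2" "own A \<subseteq> Q" "kernel (A - Q)"
  shows False
proof -
  have fA: "finite A" "card A = k" using F_D[OF A] by auto
  have fQ: "finite Q" using Q(1) fA finite_subset by blast
  define \<P> where "\<P> = insert Q ((\<lambda>x. {x}) ` (A - Q))"
  have U: "\<Union>\<P> = A" using Q unfolding \<P>_def by auto
  have Qne: "Q \<noteq> {}" using Q(2) by auto
  have "Q \<notin> (\<lambda>x. {x}) ` (A - Q)" by auto
  then have "card \<P> = Suc (card (A - Q))" unfolding \<P>_def using fA by (simp add: card_image)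
  also have "\<dots> = d - 1" using Q fA fQ d5 dk by (simp add: card_Diff_subset)
  finally have c: "card \<P> = d - 1" .
  show False
  proof (rule partition_cluster[OF A, of "{}" \<P>])
    show "disjoint \<P>" unfolding \<P>_def by (auto simp: disjoint_def)
    fix P assume "P \<in> \<P>"
    then consider "P = Q" | x where "P = {x}" "x \<in> A" "x \<notin> Q" unfolding \<P>_def by auto
    then show "\<exists>B\<in>F. B \<inter> A = A - P"
    proof cases
      case 1 then show ?thesis using kernel_avoid[OF Q(4,1) A] by simp
    next
      case 2
      then show ?thesis using not_own_avoid[OF A] Q(3) by blast
    qed
  qed (use U c fA Qne d5 in \<open>auto simp: \<P>_def\<close>)
qed

text \<open>Let \<open>Y\<close> be the points whose removal leaves no kernel; it contains
  \<open>own A\<close>. Two points of \<open>Y\<close> that include all own points can be put into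
  the large part, where \<open>kernel_Diff_pairs\<close> applies, and a cluster arises. If no such
  pair exists and \<open>A\<close> has at most two own points, then either \<open>own A\<close> is
  empty and \<open>Y\<close> has at most one point, which the large part can avoid, or
  \<open>own A = {c}\<close> and \<open>Y\<close> has no other point.\<close>

lemma regular_own:
  assumes A: "A \<in> F" and reg: "regular A"
  shows "card (own A) \<ge> 3 \<or> (\<exists>c\<in>A. own A = {c} \<and> (\<forall>x\<in>A-{c}. kernel (A - {x})))"
proof (rule ccontr)
  assume contra: "\<not> ?thesis"
  have fA: "finite A" "card A = k" using F_D[OF A] by auto
  have own_sub: "own A \<subseteq> A" unfolding own_def by auto
  have f_own: "finite (own A)" using own_sub fA finite_subset by blast
  define Y where "Y = {x\<in>A. \<not> kernel (A - {x})}"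
  have Y: "Y \<subseteq> A" "own A \<subseteq> Y" using own_not_kernel[OF A] own_sub unfolding Y_def by auto
  have le_cards: "k - d + 2 \<le> k" using d5 dk by simp
  have ext: "\<exists>Q. R \<subseteq> Q \<and> Q \<subseteq> S \<and> card Q = k - d + 2"
    if "R \<subseteq> S" "S \<subseteq> A" "card R \<le> 2" "k - d + 2 \<le> card S" for R S
  proof -
    have "finite S" using that fA finite_subset by blast
    with that show ?thesis by (intro exists_subset_between) auto
  qed
  show False
  proof (cases "\<exists>x\<in>Y. \<exists>y\<in>Y. x \<noteq> y \<and> own A \<subseteq> {x, y}")
    case True
    then obtain x y where xy: "x \<in> Y" "y \<in> Y" "x \<noteq> y" "own A \<subseteq> {x, y}" by blast
    \<comment> \<open>There is room for both points because \<open>k - d + 2\<close> is at least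
      2.\<close>
    obtain Q where Q: "{x, y} \<subseteq> Q" "Q \<subseteq> A" "card Q = k - d + 2"
      using ext[of "{x,y}" A, OF _ order.refl] xy Y fA d5 dk le_cards by auto
    have "kernel (A - Q)" using kernel_Diff_pairs[OF A reg Q(2), of x y] Q xy unfolding Y_def by auto
    then show False using big_part_cluster[OF A Q(2,3)] Q xy by auto
  next
    case False
    have "card (own A) \<le> 2" using contra by auto
    then consider "card (own A) = 0" | "card (own A) = 1" | "card (own A) = 2" by linarith
    then show False
    proof cases
      case 1
      then have o: "own A = {}" using f_own by simp
      have Y1: "card Y \<le> 1"
      proof (rule ccontr)
        assume "\<not> card Y \<le> 1"
        then obtain x y where "x \<in> Y" "y \<in> Y" "x \<noteq> y"
          by (metis card_le_Suc0_iff_eq Y(1) fA(1) finite_subset One_nat_def)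
        then show False using False o by auto
      qed
      have "card (A - Y) = k - card Y" using Y fA finite_subset by (metis card_Diff_subset)
      then have "k - d + 2 \<le> card (A - Y)" using Y1 d5 dk by simp
      then obtain Q where Q: "Q \<subseteq> A - Y" "card Q = k - d + 2" using ext[of "{}" "A - Y"] by auto
      have "kernel (A - Q)"
        by (rule kernel_Diff_singles[OF A reg]) (use Q in \<open>auto simp: Y_def\<close>)
      then show False using big_part_cluster[OF A _ Q(2)] Q(1) o by auto
    next
      case 2
      then obtain c where c: "own A = {c}" by (metis card_1_singletonE)
      then have cA: "c \<in> A" "c \<in> Y" using own_sub Y by auto
      have "\<forall>x\<in>A-{c}. kernel (A - {x})" using False c cA unfolding Y_def by auto
      then show False using contra c cA by auto
    next
      case 3
      then obtain x y where "own A = {x, y}" "x \<noteq> y" by (meson card_2_iff)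
      then show False using False Y by auto
    qed
  qed
qed

end

section \<open>A common centre\<close>

text \<open>Lists will stand for sets because their entries can be exchanged independently;
  repetitions are of lower order. A repetition in \<open>x # m\<close> is one in \<open>m\<close> or
  an occurrence of \<open>x\<close> in \<open>m\<close>, and \<open>r^2 + r\<close> is at most
  \<open>(r + 1)^2\<close>.\<close>

lemma card_lists_not_distinct:
  assumes "finite V"
  shows "card {l. set l \<subseteq> V \<and> length l = r \<and> \<not> distinct l} \<le> r\<^sup>2 * card V ^ (r - 1)"
proof (induction r)
  case 0
  have "{l. set l \<subseteq> V \<and> length l = 0 \<and> \<not> distinct l} = {}" by auto
  then show ?case by simp
next
  case (Suc r)
  let ?L = "{l. set l \<subseteq> V \<and> length l = r}"
  let ?N = "{l. set l \<subseteq> V \<and> length l = r \<and> \<not> distinct l}"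
  have finL: "finite ?L" using finite_lists_length_eq[OF assms] .
  have finN: "finite ?N" by (rule finite_subset[OF _ finL]) auto
  have sub: "{l. set l \<subseteq> V \<and> length l = Suc r \<and> \<not> distinct l}
     \<subseteq> (\<lambda>(x, l). x # l) ` (V \<times> ?N) \<union> (\<lambda>(x, l). x # l) ` (SIGMA l:?L. set l)\<inverse>"
  proof
    fix l assume "l \<in> {l. set l \<subseteq> V \<and> length l = Suc r \<and> \<not> distinct l}"
    then obtain x m where l: "l = x # m" "x \<in> V" "m \<in> ?L" "\<not> distinct m \<or> x \<in> set m" by (cases l) auto
    then have "(x, m) \<in> V \<times> ?N \<or> (x, m) \<in> (SIGMA l:?L. set l)\<inverse>" by auto
    then show "l \<in> (\<lambda>(x, l). x # l) ` (V \<times> ?N) \<union> (\<lambda>(x, l). x # l) ` (SIGMA l:?L. set l)\<inverse>"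
      using l(1) by (metis (no_types, lifting) UnI1 UnI2 image_eqI old.prod.case)
  qed
  have "card {l. set l \<subseteq> V \<and> length l = Suc r \<and> \<not> distinct l} \<le>
      card ((\<lambda>(x, l). x # l) ` (V \<times> ?N) \<union> (\<lambda>(x, l). x # l) ` (SIGMA l:?L. set l)\<inverse>)"
    using finL finN assms by (intro card_mono[OF _ sub]) auto
  also have "\<dots> \<le> card (V \<times> ?N) + card ((SIGMA l:?L. set l)\<inverse>)"
    using finL finN assms by (intro order.trans[OF card_Un_le] add_mono card_image_le) auto
  also have "card ((SIGMA l:?L. set l)\<inverse>) = card (SIGMA l:?L. set l)"
    by (simp add: card_inverse)
  also have "\<dots> = (\<Sum>l\<in>?L. card (set l))" using finL by (intro card_SigmaI) auto
  also have "\<dots> \<le> (\<Sum>l\<in>?L. r)" by (intro sum_mono) (use card_length in auto)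
  also have "\<dots> = card V ^ r * r" using card_lists_length_eq[OF assms, of r] by simp
  also have "card (V \<times> ?N) \<le> card V * (r\<^sup>2 * card V ^ (r - 1))"
    using Suc by (simp add: card_cartesian_product)
  also have "card V * (r\<^sup>2 * card V ^ (r - 1)) \<le> r\<^sup>2 * card V ^ r" by (cases r) auto
  also have "r\<^sup>2 * card V ^ r + card V ^ r * r \<le> (Suc r)\<^sup>2 * card V ^ (Suc r - 1)"
    by (simp add: power2_eq_square algebra_simps)
  finally show ?case by simp
qed

text \<open>Two lists are joined by the chain that replaces entries one at a time from the left.
  A fixed position of a uniformly random chain is uniformly distributed, so most chains avoid
  the exceptional lists altogether.\<close>

lemma locally_constant_almost_constant:
  fixes g :: "'a list \<Rightarrow> 'c"
  assumes V: "finite V"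
    and L: "L = {l. set l \<subseteq> V \<and> length l = r}" and G: "G \<subseteq> L"
    and loc: "\<And>l i y. l \<in> G \<Longrightarrow> i < r \<Longrightarrow> l[i := y] \<in> G \<Longrightarrow> g (l[i := y]) = g l"
  shows "\<exists>c. card {b\<in>L. b \<notin> G \<or> g b \<noteq> c} \<le> (r + 1) * card (L - G)"
proof (cases "L = {}")
  case False
  have finL: "finite L" unfolding L using finite_lists_length_eq[OF V] .
  \<comment> \<open>The chain from \<open>a\<close> to \<open>b\<close>: after \<open>i\<close>
    steps the first \<open>i\<close> entries come from \<open>b\<close>.\<close>
  define mix where "mix i a b = take i b @ drop i a" for i and a b :: "'a list"
  have mixL: "mix i a b \<in> L" if "a \<in> L" "b \<in> L" for i a b
    using that unfolding L mix_def by (auto dest: in_set_takeD in_set_dropD)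
  define X where "X i = {(a, b) \<in> L \<times> L. mix i a b \<notin> G}" for i
  have cX: "card (X i) \<le> card (L - G) * card L" for i
  proof -
    \<comment> \<open>This is the uniform distribution of position \<open>i\<close>:
      \<open>a\<close> and \<open>b\<close> can be recovered from the two complementary mixes, so
      fixing the first mix leaves at most \<open>card L\<close> pairs.\<close>
    have "card (X i) \<le> card ((L - G) \<times> L)"
    proof (rule card_inj_on_le[where f = "\<lambda>(a, b). (mix i a b, mix i b a)"])
      show "inj_on (\<lambda>(a, b). (mix i a b, mix i b a)) (X i)"
      proof (rule inj_onI)
        fix p q assume pq: "p \<in> X i" "q \<in> X i"
          "(case p of (a, b) \<Rightarrow> (mix i a b, mix i b a)) = (case q of (a, b) \<Rightarrow> (mix i a b, mix i b a))"
        obtain a b a' b' where ab: "p = (a, b)" "q = (a', b')" by (cases p, cases q)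
        have len: "length a = r" "length b = r" "length a' = r" "length b' = r"
          using pq ab unfolding X_def L by auto
        have "take i b @ drop i a = take i b' @ drop i a'" "take i a @ drop i b = take i a' @ drop i b'"
          using pq ab unfolding mix_def by auto
        then have "take i b = take i b'" "drop i a = drop i a'" "take i a = take i a'" "drop i b = drop i b'"
          using len by auto
        then show "p = q" using ab by (metis append_take_drop_id)
      qed
      show "(\<lambda>(a, b). (mix i a b, mix i b a)) ` X i \<subseteq> (L - G) \<times> L"
        using mixL unfolding X_def by auto
    qed (use finL in auto)
    then show ?thesis by (simp add: card_cartesian_product)
  qed
  define Y where "Y a = {b\<in>L. \<exists>i\<le>r. mix i a b \<notin> G}" for a
  have finX: "finite (X i)" for i
    unfolding X_def by (rule finite_subset[of _ "L \<times> L"]) (use finL in auto)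
  have "(\<Sum>a\<in>L. card (Y a)) = card (SIGMA a:L. Y a)"
    using finL unfolding Y_def by (intro card_SigmaI[symmetric]) auto
  also have "(SIGMA a:L. Y a) = (\<Union>i\<in>{..r}. X i)" unfolding X_def Y_def by auto
  also have "card \<dots> \<le> (\<Sum>i\<in>{..r}. card (X i))" by (rule card_UN_le) simp
  also have "\<dots> \<le> (\<Sum>i\<in>{..r}. card (L - G) * card L)" by (rule sum_mono[OF cX])
  also have "\<dots> = (\<Sum>a\<in>L. (r + 1) * card (L - G))" by (simp add: algebra_simps)
  finally have le: "(\<Sum>a\<in>L. card (Y a)) \<le> (\<Sum>a\<in>L. (r + 1) * card (L - G))" .
  \<comment> \<open>Averaging over starting lists: some \<open>a\<close> has at most the mean number
    of endpoints whose chain meets an exceptional list.\<close>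
  obtain a where a: "a \<in> L" "card (Y a) \<le> (r + 1) * card (L - G)"
  proof -
    have "\<exists>a\<in>L. card (Y a) \<le> (r + 1) * card (L - G)"
    proof (rule ccontr)
      assume "\<not> ?thesis"
      then have "(\<Sum>a\<in>L. (r + 1) * card (L - G)) < (\<Sum>a\<in>L. card (Y a))"
        using finL False by (intro sum_strict_mono) auto
      then show False using le by simp
    qed
    then show ?thesis using that by blast
  qed
  have len_a: "length a = r" using a(1) unfolding L by simp
  have "{b\<in>L. b \<notin> G \<or> g b \<noteq> g a} \<subseteq> Y a"
  proof
    fix b assume b: "b \<in> {b\<in>L. b \<notin> G \<or> g b \<noteq> g a}"
    show "b \<in> Y a"
    proof (rule ccontr)
      assume "b \<notin> Y a"
      then have good: "mix i a b \<in> G" if "i \<le> r" for i using b that unfolding Y_def by auto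
      have len_b: "length b = r" using b unfolding L by simp
      have "g (mix i a b) = g a" if "i \<le> r" for i
        using that
      proof (induction i)
        case (Suc i)
        have "mix (Suc i) a b = (mix i a b)[i := b ! i]"
          using Suc.prems len_a len_b unfolding mix_def
          by (intro nth_equalityI) (auto simp: nth_append nth_list_update less_Suc_eq)
        then show ?case using loc[of "mix i a b" i "b ! i"] good[of i] good[of "Suc i"] Suc by simp
      qed (simp add: mix_def)
      from this[of r] have "g b = g a" "b \<in> G" using good[of r] len_a len_b by (auto simp: mix_def)
      then show False using b by auto
    qed
  qed
  then have "card {b\<in>L. b \<notin> G \<or> g b \<noteq> g a} \<le> card (Y a)"
    using finL by (intro card_mono) (auto simp: Y_def)
  then show ?thesis using a(2) by (meson le_trans)
qed simp

text \<open>The factor \<open>k\<close> counts the lists on a chain over \<open>k - 1\<close>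
  positions. In the bracket are the exceptional lists: at most \<open>(k - 1) ^ (k - 1)\<close> for
  each uncoloured set of \<open>card_uncentered_uncoloured\<close>, and those with a
  repetition.\<close>

definition star_const :: "nat \<Rightarrow> nat \<Rightarrow> nat" where
  "star_const k L = k * ((k - 1) ^ (k - 1) * (2 * (L + 2 * k ^ 3)) + (k - 1)\<^sup>2)"

section \<open>Centred members and the colours of (k-1)-sets\<close>

context cluster_free_family
begin

definition centered :: "'a \<Rightarrow> 'a set \<Rightarrow> bool" where
  "centered c A \<longleftrightarrow> A \<in> F \<and> regular A \<and> own A = {c} \<and> (\<forall>x\<in>A-{c}. kernel (A - {x}))"

text \<open>The relation \<open>centered\<close> seen from the (k-1)-set \<open>T = A - {c}\<close>.
  The colour of \<open>T\<close> is unique because \<open>c\<close> is an own point, so only one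
  member contains \<open>T\<close>.\<close>

definition coloured :: "'a \<Rightarrow> 'a set \<Rightarrow> bool" where
  "coloured c T \<longleftrightarrow> c \<notin> T \<and> centered c (insert c T)"

lemma coloured_superset:
  assumes "coloured c T" "B \<in> F" "T \<subseteq> B"
  shows "B = insert c T"
proof -
  have "c \<in> own (insert c T)" "insert c T - {c} = T" using assms unfolding coloured_def centered_def by auto
  then show ?thesis using assms(2,3) unfolding own_def by auto
qed

lemma coloured_unique:
  assumes "coloured c T" "coloured c' T" shows "c = c'"
proof -
  have "insert c' T = insert c T"
    using coloured_superset[OF assms(1), of "insert c' T"] assms(2)
    unfolding coloured_def centered_def by auto
  then show ?thesis using assms unfolding coloured_def by auto
qed

text \<open>With different colours the members \<open>A\<close> and \<open>A'\<close> meet exactly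
  in \<open>R\<close>, so their union has at most \<open>k + 2\<close> points. Splitting the
  \<open>k - 2\<close> points of \<open>R\<close> into one part of size \<open>k - d + 1\<close> and
  \<open>d - 3\<close> single points adds \<open>d - 2\<close> members and at most
  \<open>k - 2\<close> points: \<open>d\<close> members on at most \<open>2 * k\<close> points.
  Every part avoids \<open>c\<close>, so its removal from \<open>A\<close> leaves a kernel.\<close>

lemma coloured_adjacent:
  assumes c: "coloured c (insert u R)" and c': "coloured c' (insert v R)" and uv: "u \<notin> R" "v \<notin> R"
  shows "c = c'"
proof (rule ccontr)
  assume ne: "c \<noteq> c'"
  have "u \<noteq> v" using ne coloured_unique c c' by blast
  define A where "A = insert c (insert u R)"
  define A' where "A' = insert c' (insert v R)"
  have A: "A \<in> F" "regular A" "own A = {c}" "c \<notin> insert u R" "\<And>x. x \<in> A - {c} \<Longrightarrow> kernel (A - {x})"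
    using c unfolding coloured_def centered_def A_def by auto
  have A': "A' \<in> F" "own A' = {c'}" "c' \<notin> insert v R"
    using c' unfolding coloured_def centered_def A'_def by auto
  \<comment> \<open>Otherwise \<open>A'\<close> contains the coloured set \<open>insert u R\<close>,
    hence equals \<open>A\<close>, although the own points differ.\<close>
  have "c' \<noteq> u"
  proof
    assume "c' = u"
    then have "A' = A" using coloured_superset[OF c A'(1)] unfolding A'_def A_def by auto
    then show False using A(3) A'(2) ne by auto
  qed
  moreover have "c \<noteq> v"
  proof
    assume "c = v"
    then have "A = A'" using coloured_superset[OF c' A(1)] unfolding A'_def A_def by auto
    then show False using A(3) A'(2) ne by auto
  qed
  ultimately have int: "A' \<inter> A = R" using ne \<open>u \<noteq> v\<close> uv A(4) A'(3) unfolding A_def A'_def by auto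
  have fA: "finite A" "card A = k" using F_D[OF A(1)] by auto
  have fR: "finite R" using fA unfolding A_def by auto
  have cR: "card R = k - 2" using fA A(4) uv fR unfolding A_def by simp
  have cQ: "k - d + 1 \<le> k - 2" using d5 dk by linarith
  obtain Q where Q: "Q \<subseteq> R" "card Q = k - d + 1"
    using obtain_subset_with_card_n[of "k - d + 1" R] cR cQ by auto
  have fQ: "finite Q" using Q fR finite_subset by blast
  define \<P> where "\<P> = insert Q ((\<lambda>x. {x}) ` (R - Q))"
  have U: "\<Union>\<P> = R" using Q unfolding \<P>_def by auto
  have Qne: "Q \<noteq> {}" using Q(2) by auto
  have "Q \<notin> (\<lambda>x. {x}) ` (R - Q)" by auto
  then have "card \<P> = Suc (card (R - Q))" unfolding \<P>_def using fR by (simp add: card_image)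
  also have "\<dots> = d - 2" using Q fR fQ cR d5 dk by (simp add: card_Diff_subset)
  finally have cP: "card \<P> = d - 2" .
  have "A \<union> \<Union>{A'} = insert c' (insert v A)" unfolding A_def A'_def by auto
  then have "card (A \<union> \<Union>{A'}) \<le> k + 2"
    using fA card_insert_le_m1[of "Suc (Suc k)" "insert v A" c'] by (simp add: card_insert_if)
  then have c2: "card (A \<union> \<Union>{A'}) + card (\<Union>\<P>) \<le> 2 * k" using U cR d5 dk by simp
  show False
  proof (rule partition_cluster[OF A(1), of "{A'}" \<P>])
    show "disjoint \<P>" unfolding \<P>_def by (auto simp: disjoint_def)
    show "A \<notin> {A'}" using A(3) A'(2) ne by auto
    show "{} \<notin> \<P>" "finite \<P>" using Qne fR unfolding \<P>_def by auto
    show "\<Union>\<P> \<subseteq> A" unfolding U A_def by auto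
    show "card \<P> + card {A'} + 1 = d" using cP d5 by simp
    show "A \<inter> \<Inter>{A'} \<subseteq> \<Union>\<P>" using int U by auto
    fix P assume P: "P \<in> \<P>"
    then have PR: "P \<subseteq> R" "P \<noteq> {}" using Q Qne unfolding \<P>_def by auto
    then have PA: "P \<subseteq> A" "c \<notin> P" using A(4) unfolding A_def by auto
    have "kernel (A - P)"
      by (rule kernel_Diff_singles[OF A(1,2) PA(1) PR(2)]) (use A(5) PA in auto)
    then show "\<exists>B\<in>F. B \<inter> A = A - P" by (rule kernel_avoid[OF _ PA(1) A(1)])
    fix B assume "B \<in> {A'}"
    then show "B \<inter> A \<noteq> A - P" using int PA A(4) unfolding A_def by auto
  qed (use A'(1) c2 in auto)
qed

lemma centered_Diff_own:
  assumes "centered c A" shows "coloured c (A - own A)" "A - own A \<in> nsets V (k - 1)"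
proof -
  have o: "own A = {c}" "A \<in> F" "c \<in> A" using assms unfolding centered_def own_def by auto
  then have "insert c (A - {c}) = A" by auto
  then show "coloured c (A - own A)" using assms o unfolding coloured_def by simp
  show "A - own A \<in> nsets V (k - 1)" using F_D[OF o(2)] o by (auto simp: nsets_def)
qed

lemma inj_on_Diff_own: "inj_on (\<lambda>A. A - own A) {A. \<exists>c. centered c A}"
proof (rule inj_onI)
  fix A B assume "A \<in> {A. \<exists>c. centered c A}" "B \<in> {A. \<exists>c. centered c A}" and eq: "A - own A = B - own B"
  then obtain c c' where c: "centered c A" "centered c' B" by auto
  have F: "A \<in> F" "B \<in> F" using c unfolding centered_def by auto
  have "A - own A \<subseteq> B" "A - own A \<subseteq> A" using eq by auto
  then show "A = B" using coloured_superset[OF centered_Diff_own(1)[OF c(1)]] F by metis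
qed

text \<open>By \<open>regular_own\<close>, a regular member that is not centred has three own
  points, a surplus of two. The own points total at most \<open>card V choose (k - 1)\<close>, which
  exceeds \<open>card F\<close> by at most \<open>L * card V ^ (k - 2)\<close>, so up to the
  irregular members there are few of these. Hence most members are centred, and they inject into the
  coloured sets.\<close>

lemma card_uncentered_uncoloured:
  assumes large: "card V choose (k - 1) \<le> card F + L * card V ^ (k - 2)"
  shows "card {A\<in>F. \<not> (\<exists>c. centered c A)} \<le> (L + 4 * k ^ 3) * card V ^ (k - 2)"
    and "card {T\<in>nsets V (k - 1). \<not> (\<exists>c. coloured c T)} \<le> 2 * (L + 2 * k ^ 3) * card V ^ (k - 2)"
proof -
  define N where "N = card V ^ (k - 2)"
  define I where "I = {A\<in>F. \<not> regular A}"
  define R1 where "R1 = {A\<in>F. \<exists>c. centered c A}"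
  define R3 where "R3 = {A\<in>F. regular A \<and> \<not> (\<exists>c. centered c A)}"
  define G where "G = {T\<in>nsets V (k - 1). \<exists>c. coloured c T}"
  define B where "B = {T\<in>nsets V (k - 1). \<not> (\<exists>c. coloured c T)}"
  have fin: "finite I" "finite R1" "finite R3" using finF unfolding I_def R1_def R3_def by auto
  have finGB: "finite G" "finite B" using finite_imp_finite_nsets[OF finV] unfolding G_def B_def by auto
  have cI: "card I \<le> 2 * k ^ 3 * N" using card_irregular unfolding I_def N_def .
  have F_eq: "F = I \<union> (R1 \<union> R3)" unfolding I_def R1_def R3_def by auto
  have d1: "R1 \<inter> R3 = {}" "I \<inter> (R1 \<union> R3) = {}" unfolding I_def R1_def R3_def centered_def by auto
  have cF: "card F = card I + (card R1 + card R3)"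
    using card_Un_disjoint[of I "R1 \<union> R3"] card_Un_disjoint[of R1 R3] fin d1 F_eq by simp
  have "card R1 + 3 * card R3 \<le> (\<Sum>A\<in>R1. card (own A)) + (\<Sum>A\<in>R3. card (own A))"
  proof (rule add_mono)
    have "(\<Sum>A\<in>R1. 1) \<le> (\<Sum>A\<in>R1. card (own A))"
      by (rule sum_mono) (auto simp: R1_def centered_def)
    then show "card R1 \<le> (\<Sum>A\<in>R1. card (own A))" by simp
    have "(\<Sum>A\<in>R3. 3) \<le> (\<Sum>A\<in>R3. card (own A))"
    proof (rule sum_mono)
      fix A assume "A \<in> R3"
      then show "3 \<le> card (own A)" using regular_own[of A] unfolding R3_def centered_def by blast
    qed
    then show "3 * card R3 \<le> (\<Sum>A\<in>R3. card (own A))" by simp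
  qed
  also have "\<dots> = (\<Sum>A\<in>R1 \<union> R3. card (own A))" using fin d1 by (simp add: sum.union_disjoint)
  also have "\<dots> \<le> (\<Sum>A\<in>F. card (own A))" using finF F_eq by (intro sum_mono2) auto
  also note sum_card_own
  finally have own: "card R1 + 3 * card R3 \<le> card V choose (k - 1)" .
  have LN: "card V choose (k - 1) \<le> card F + L * N" using large unfolding N_def .
  have a1: "2 * card R3 \<le> (L + 2 * k ^ 3) * N" using own LN cF cI by (simp add: algebra_simps)
  have "card {A\<in>F. \<not> (\<exists>c. centered c A)} \<le> card (I \<union> R3)"
    using fin by (intro card_mono) (auto simp: I_def R3_def)
  also have "\<dots> \<le> card I + card R3" by (rule card_Un_le)
  also have "\<dots> \<le> (L + 4 * k ^ 3) * N" using a1 cI by (simp add: algebra_simps)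
  finally show "card {A\<in>F. \<not> (\<exists>c. centered c A)} \<le> (L + 4 * k ^ 3) * card V ^ (k - 2)" unfolding N_def .
  have "card R1 \<le> card G"
  proof (rule card_inj_on_le[where f = "\<lambda>A. A - own A"])
    show "inj_on (\<lambda>A. A - own A) R1" by (rule inj_on_subset[OF inj_on_Diff_own]) (auto simp: R1_def)
    show "(\<lambda>A. A - own A) ` R1 \<subseteq> G" using centered_Diff_own unfolding R1_def G_def by blast
  qed (rule finGB)
  moreover have "card G + card B = card V choose (k - 1)"
  proof -
    have "nsets V (k - 1) = G \<union> B" "G \<inter> B = {}" unfolding G_def B_def by auto
    then show ?thesis using finGB by (metis card_Un_disjoint card_nsets)
  qed
  ultimately have "card B \<le> 2 * (L + 2 * k ^ 3) * N"
    using a1 LN cF cI by (simp add: algebra_simps)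
  then show "card {T\<in>nsets V (k - 1). \<not> (\<exists>c. coloured c T)} \<le> 2 * (L + 2 * k ^ 3) * card V ^ (k - 2)"
    unfolding B_def N_def .
qed

text \<open>The colour is carried over to lists without repetition. Changing one entry of such a
  list exchanges one point of the set, so by \<open>coloured_adjacent\<close> the colour is locally
  constant and \<open>locally_constant_almost_constant\<close> applies.\<close>

lemma almost_all_one_colour:
  assumes large: "card V choose (k - 1) \<le> card F + L * card V ^ (k - 2)"
  shows "\<exists>x. card {T\<in>nsets V (k - 1). \<not> coloured x T} \<le> star_const k L * card V ^ (k - 2)"
proof -
  define r where "r = k - 1"
  have r: "r + 1 = k" "r - 1 = k - 2" using d5 dk unfolding r_def by auto
  define N where "N = card V ^ (k - 2)"
  define Ls where "Ls = {l. set l \<subseteq> V \<and> length l = r}"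
  define g where "g l = (THE c. coloured c (set l))" for l
  define G where "G = {l \<in> Ls. distinct l \<and> (\<exists>c. coloured c (set l))}"
  define B where "B = {T\<in>nsets V r. \<not> (\<exists>c. coloured c T)}"
  have cB: "card B \<le> 2 * (L + 2 * k ^ 3) * N"
    using card_uncentered_uncoloured(2)[OF large] unfolding B_def N_def r_def .
  have finLs: "finite Ls" unfolding Ls_def using finite_lists_length_eq[OF finV] .
  have finB: "finite B" unfolding B_def using finite_imp_finite_nsets[OF finV] by simp
  have gI: "g l = c" if "coloured c (set l)" for l c
    unfolding g_def using that coloured_unique by blast
  have "\<exists>c. card {b\<in>Ls. b \<notin> G \<or> g b \<noteq> c} \<le> (r + 1) * card (Ls - G)"
  proof (rule locally_constant_almost_constant[OF finV Ls_def])
    show "G \<subseteq> Ls" unfolding G_def by auto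
    fix l i y assume l: "l \<in> G" "i < r" "l[i := y] \<in> G"
    define R where "R = set l - {l ! i}"
    have len: "length l = r" "distinct l" "distinct (l[i := y])" using l unfolding G_def Ls_def by auto
    have s: "set l = insert (l ! i) R" using l(2) len unfolding R_def by auto
    have s': "set (l[i := y]) = insert y R"
      using l(2) len unfolding R_def by (simp add: set_update_distinct)
    have "card R = r - 1" using s len l(2) distinct_card[OF len(2)] by (simp add: R_def)
    moreover have "card (insert y R) = r" using distinct_card[OF len(3)] len s' by simp
    ultimately have "y \<notin> R" using l(2) by (auto simp: insert_absorb)
    obtain c c' where c: "coloured c (set l)" "coloured c' (set (l[i := y]))" using l unfolding G_def by auto
    have "c = c'"
      using coloured_adjacent[of c "l ! i" R c' y] c \<open>y \<notin> R\<close> unfolding s s' by (simp add: R_def)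
    then show "g (l[i := y]) = g l" using gI c by metis
  qed
  then obtain x where x: "card {b\<in>Ls. b \<notin> G \<or> g b \<noteq> x} \<le> (r + 1) * card (Ls - G)" by blast
  have fT: "finite {l. set l \<subseteq> T \<and> length l = r}" "card {l. set l \<subseteq> T \<and> length l = r} = r ^ r" if "T \<in> B" for T
    using that finite_lists_length_eq[of T] card_lists_length_eq[of T] unfolding B_def by (auto simp: nsets_def)
  \<comment> \<open>Exceptional lists either have a repetition or list an uncoloured set; the latter
    are bounded generously by all lists over that set.\<close>
  have sub: "Ls - G \<subseteq> (\<Union>T\<in>B. {l. set l \<subseteq> T \<and> length l = r}) \<union>
      {l. set l \<subseteq> V \<and> length l = r \<and> \<not> distinct l}"
  proof
    fix l assume l: "l \<in> Ls - G"
    show "l \<in> (\<Union>T\<in>B. {l. set l \<subseteq> T \<and> length l = r}) \<union> {l. set l \<subseteq> V \<and> length l = r \<and> \<not> distinct l}"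
    proof (cases "distinct l")
      case True
      then have "set l \<in> B" using l unfolding Ls_def G_def B_def by (auto simp: nsets_def distinct_card)
      then show ?thesis using l unfolding Ls_def by auto
    qed (use l in \<open>auto simp: Ls_def\<close>)
  qed
  have fd: "finite {l. set l \<subseteq> V \<and> length l = r \<and> \<not> distinct l}"
    by (rule finite_subset[OF _ finLs]) (auto simp: Ls_def)
  have "card (Ls - G) \<le> card ((\<Union>T\<in>B. {l. set l \<subseteq> T \<and> length l = r}) \<union>
      {l. set l \<subseteq> V \<and> length l = r \<and> \<not> distinct l})"
    using finB fT fd by (intro card_mono[OF _ sub]) auto
  also have "\<dots> \<le> card (\<Union>T\<in>B. {l. set l \<subseteq> T \<and> length l = r}) + r\<^sup>2 * card V ^ (r - 1)"
    by (intro order.trans[OF card_Un_le] add_mono card_lists_not_distinct finV) simp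
  also have "card (\<Union>T\<in>B. {l. set l \<subseteq> T \<and> length l = r}) \<le> (\<Sum>T\<in>B. card {l. set l \<subseteq> T \<and> length l = r})"
    by (rule card_UN_le[OF finB])
  also have "\<dots> = card B * r ^ r" using fT by simp
  also have "\<dots> \<le> (2 * (L + 2 * k ^ 3) * N) * r ^ r" by (rule mult_right_mono[OF cB]) simp
  also have "(2 * (L + 2 * k ^ 3) * N) * r ^ r + r\<^sup>2 * card V ^ (r - 1) =
      (r ^ r * (2 * (L + 2 * k ^ 3)) + r\<^sup>2) * N" unfolding N_def r(2) by (simp add: algebra_simps)
  finally have "(r + 1) * card (Ls - G) \<le> (r + 1) * ((r ^ r * (2 * (L + 2 * k ^ 3)) + r\<^sup>2) * N)"
    by (rule mult_left_mono) simp_all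
  also have "\<dots> = star_const k L * N" unfolding star_const_def r(1) by (simp add: r_def mult.assoc)
  finally have b1: "(r + 1) * card (Ls - G) \<le> star_const k L * N" .
  \<comment> \<open>One ordering for each set is enough: a set not coloured by \<open>x\<close> has
    only exceptional orderings.\<close>
  define lst where "lst T = (SOME l. set l = T \<and> distinct l)" for T :: "'a set"
  have lst: "set (lst T) = T" "distinct (lst T)" if "T \<in> nsets V r" for T
  proof -
    have "\<exists>l. set l = T \<and> distinct l" using that finite_distinct_list[of T] by (auto simp: nsets_def)
    from someI_ex[OF this] show "set (lst T) = T" "distinct (lst T)" unfolding lst_def by auto
  qed
  have "card {T\<in>nsets V r. \<not> coloured x T} \<le> card {b\<in>Ls. b \<notin> G \<or> g b \<noteq> x}"
  proof (rule card_inj_on_le[where f = lst])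
    show "inj_on lst {T\<in>nsets V r. \<not> coloured x T}" using lst by (intro inj_on_inverseI[where g = set]) auto
    show "lst ` {T\<in>nsets V r. \<not> coloured x T} \<subseteq> {b\<in>Ls. b \<notin> G \<or> g b \<noteq> x}"
    proof (intro image_subsetI)
      fix T assume T: "T \<in> {T\<in>nsets V r. \<not> coloured x T}"
      then have l: "set (lst T) = T" "distinct (lst T)" using lst by auto
      have "lst T \<in> Ls" using T l distinct_card[OF l(2)] unfolding Ls_def by (auto simp: nsets_def)
      moreover have "g (lst T) \<noteq> x" if "lst T \<in> G"
        using that gI T l(1) unfolding G_def by auto
      ultimately show "lst T \<in> {b\<in>Ls. b \<notin> G \<or> g b \<noteq> x}" by auto
    qed
  qed (use finLs in auto)
  then show ?thesis using x b1 unfolding r_def N_def by (meson le_trans)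
qed

text \<open>A centred member \<open>A\<close> that avoids \<open>x\<close> has another centre, so by
  uniqueness \<open>A - own A\<close> is not coloured by \<open>x\<close>; and \<open>S\<close> with
  \<open>insert x S\<close> outside \<open>F\<close> is not coloured by \<open>x\<close> either. The
  assumption \<open>big\<close> guarantees a set coloured by \<open>x\<close>, which puts
  \<open>x\<close> into \<open>V\<close>.\<close>

lemma star_structure:
  assumes large: "card V choose (k - 1) \<le> card F + L * card V ^ (k - 2)"
    and big: "star_const k L * card V ^ (k - 2) < card V choose (k - 1)"
  shows "\<exists>x\<in>V. card {A\<in>F. x \<notin> A} \<le> (L + 4 * k ^ 3 + star_const k L) * card V ^ (k - 2) \<and>
     card {S\<in>nsets (V - {x}) (k - 1). insert x S \<notin> F} \<le> star_const k L * card V ^ (k - 2)"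
proof -
  define N where "N = card V ^ (k - 2)"
  obtain x where x: "card {T\<in>nsets V (k - 1). \<not> coloured x T} \<le> star_const k L * N"
    using almost_all_one_colour[OF large] unfolding N_def by blast
  have fin: "finite (nsets V (k - 1))" by (rule finite_imp_finite_nsets[OF finV])
  have "{T\<in>nsets V (k - 1). \<not> coloured x T} \<noteq> nsets V (k - 1)"
    using x big unfolding N_def by (metis card_nsets leD)
  then obtain T where "coloured x T" by auto
  then have xV: "x \<in> V" using F_D unfolding coloured_def centered_def by blast
  have "card {A\<in>F. x \<notin> A} \<le> card ({A\<in>F. \<not> (\<exists>c. centered c A)} \<union> {A\<in>F. x \<notin> A \<and> (\<exists>c. centered c A)})"
    using finF by (intro card_mono) auto
  also have "\<dots> \<le> card {A\<in>F. \<not> (\<exists>c. centered c A)} + card {A\<in>F. x \<notin> A \<and> (\<exists>c. centered c A)}"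
    by (rule card_Un_le)
  also have "card {A\<in>F. \<not> (\<exists>c. centered c A)} \<le> (L + 4 * k ^ 3) * N"
    using card_uncentered_uncoloured(1)[OF large] unfolding N_def .
  also have "card {A\<in>F. x \<notin> A \<and> (\<exists>c. centered c A)} \<le> card {T\<in>nsets V (k - 1). \<not> coloured x T}"
  proof (rule card_inj_on_le[where f = "\<lambda>A. A - own A"])
    show "inj_on (\<lambda>A. A - own A) {A\<in>F. x \<notin> A \<and> (\<exists>c. centered c A)}"
      by (rule inj_on_subset[OF inj_on_Diff_own]) auto
    show "(\<lambda>A. A - own A) ` {A\<in>F. x \<notin> A \<and> (\<exists>c. centered c A)} \<subseteq> {T\<in>nsets V (k - 1). \<not> coloured x T}"
    proof (intro image_subsetI)
      fix A assume A: "A \<in> {A\<in>F. x \<notin> A \<and> (\<exists>c. centered c A)}"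
      then obtain c where c: "centered c A" by auto
      then have "c \<in> A" unfolding centered_def own_def by auto
      then have "c \<noteq> x" using A by auto
      then have "\<not> coloured x (A - own A)" using coloured_unique centered_Diff_own(1)[OF c] by blast
      then show "A - own A \<in> {T\<in>nsets V (k - 1). \<not> coloured x T}" using centered_Diff_own(2)[OF c] by auto
    qed
  qed (use fin in auto)
  also note x
  also have "(L + 4 * k ^ 3) * N + star_const k L * N = (L + 4 * k ^ 3 + star_const k L) * N"
    by (simp add: algebra_simps)
  finally have D: "card {A\<in>F. x \<notin> A} \<le> (L + 4 * k ^ 3 + star_const k L) * N" by simp
  have "{S\<in>nsets (V - {x}) (k - 1). insert x S \<notin> F} \<subseteq> {T\<in>nsets V (k - 1). \<not> coloured x T}"
    unfolding coloured_def centered_def by (auto simp: nsets_def)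
  then have "card {S\<in>nsets (V - {x}) (k - 1). insert x S \<notin> F} \<le> card {T\<in>nsets V (k - 1). \<not> coloured x T}"
    using fin by (intro card_mono) auto
  then show ?thesis using xV D x unfolding N_def by (meson le_trans)
qed

end

section \<open>Sets avoiding the centre\<close>

context cluster_free_family
begin

definition missing :: "'a \<Rightarrow> 'a set set" where
  "missing x = {S \<in> nsets (V - {x}) (k - 1). insert x S \<notin> F}"

text \<open>The multiplicity of \<open>e\<close> in the multigraph that \<open>B\<close> induces on the complement of
  \<open>insert x B\<close>.\<close>

definition weight :: "'a \<Rightarrow> 'a set \<Rightarrow> 'a set \<Rightarrow> nat" where
  "weight x B e = card {b\<in>B. insert x (insert b e) \<in> F}"

text \<open>The common form of the clusters around a member avoiding the centre: everything lies in
  \<open>B \<union> Q\<close>, so only an empty common trace on \<open>B\<close> remains to be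
  arranged.\<close>

lemma star_cluster:
  assumes B: "B \<in> F" "x \<notin> B"
    and \<S>: "\<S> \<subseteq> F" "card \<S> = d - 1" "\<And>S. S \<in> \<S> \<Longrightarrow> x \<in> S \<and> S \<subseteq> B \<union> Q" "B \<inter> \<Inter>\<S> = {}"
    and Q: "finite Q" "card Q \<le> k"
  shows False
proof -
  have fB: "finite B" "card B = k" using F_D[OF B(1)] by auto
  have "finite \<S>" using \<S>(1) finF finite_subset by blast
  moreover have "B \<notin> \<S>" using B(2) \<S>(3) by auto
  ultimately have "card (insert B \<S>) = d" using \<S>(2) d5 by simp
  moreover have "card (\<Union>(insert B \<S>)) \<le> 2 * k"
  proof -
    have "card (\<Union>(insert B \<S>)) \<le> card (B \<union> Q)" using \<S>(3) fB Q by (intro card_mono) auto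
    also have "\<dots> \<le> card B + card Q" by (rule card_Un_le)
    finally show ?thesis using fB Q by simp
  qed
  moreover have "\<Inter>(insert B \<S>) = {}" using \<S>(4) by simp
  ultimately show False using no_cluster[of "insert B \<S>"] B(1) \<S>(1) by auto
qed

text \<open>Otherwise \<open>B\<close>, \<open>insert x Y\<close> and \<open>d - 2\<close> of the
  sets \<open>insert x (insert b e)\<close> with \<open>e\<close> inside \<open>Y\<close> form a
  cluster on \<open>B \<union> insert x Y\<close>. Since \<open>insert x Y\<close> is disjoint from
  \<open>B\<close>, nothing is asked of the points \<open>b\<close>.\<close>

lemma weight_sum_less:
  assumes B: "B \<in> F" "x \<notin> B" and Y: "Y \<in> nsets (V - insert x B) (k - 1)" "insert x Y \<in> F"
  shows "(\<Sum>e\<in>nsets Y (k - 2). weight x B e) < d - 2"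
proof (rule ccontr)
  assume contra: "\<not> ?thesis"
  have fB: "finite B" using F_D[OF B(1)] by auto
  have fY: "finite Y" "card Y = k - 1" "Y \<inter> B = {}" "x \<notin> Y" using Y by (auto simp: nsets_def)
  define P where "P = (SIGMA e:nsets Y (k - 2). {b\<in>B. insert x (insert b e) \<in> F})"
  have "card P = (\<Sum>e\<in>nsets Y (k - 2). weight x B e)"
    unfolding P_def weight_def using fB finite_imp_finite_nsets[OF fY(1)] by (intro card_SigmaI) auto
  then have "d - 2 \<le> card P" using contra by simp
  then obtain P' where P': "P' \<subseteq> P" "card P' = d - 2" "finite P'"
    by (rule obtain_subset_with_card_n)
  define h where "h = (\<lambda>(e, b). insert x (insert b e))"
  have eq: "h p \<inter> B = {snd p}" "h p \<inter> Y = fst p" if "p \<in> P" for p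
    using that B(2) fY unfolding h_def P_def by (auto simp: nsets_def)
  have "inj_on h P" using eq by (intro inj_onI) (metis prod_eq_iff singleton_inject)
  then have cimg: "card (h ` P') = d - 2" using P' by (metis card_image inj_on_subset)
  have nimg: "insert x Y \<notin> h ` P'"
  proof
    assume "insert x Y \<in> h ` P'"
    then obtain p where "p \<in> P" "h p = insert x Y" using P'(1) by auto
    then show False using eq(1)[of p] fY(3) B(2) by auto
  qed
  show False
  proof (rule star_cluster[OF B, of "insert (insert x Y) (h ` P')" "insert x Y"])
    show "insert (insert x Y) (h ` P') \<subseteq> F"
      using Y(2) P'(1) unfolding h_def P_def by auto
    show "card (insert (insert x Y) (h ` P')) = d - 1" using nimg cimg P'(3) d5 by simp
    show "B \<inter> \<Inter>(insert (insert x Y) (h ` P')) = {}" using fY(3) B(2) by auto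
    show "card (insert x Y) \<le> k" using fY d5 dk by simp
    fix S assume "S \<in> insert (insert x Y) (h ` P')"
    then show "x \<in> S \<and> S \<subseteq> B \<union> insert x Y"
      using P'(1) unfolding h_def P_def by (auto simp: nsets_def)
  qed (use fY in auto)
qed

text \<open>Here a cluster consists of \<open>B\<close> and \<open>d - 1\<close> sets over the same
  \<open>e\<close>; two different points \<open>b\<close> already give an empty trace on
  \<open>B\<close>. This holds for every \<open>e\<close>, whether or not the sets around it are
  missing.\<close>

lemma weight_le:
  assumes B: "B \<in> F" "x \<notin> B" and e: "e \<in> nsets (V - insert x B) (k - 2)"
  shows "weight x B e \<le> d - 2"
proof (rule ccontr)
  assume contra: "\<not> ?thesis"
  have fe: "finite e" "card e = k - 2" "e \<inter> B = {}" "x \<notin> e" using e by (auto simp: nsets_def)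
  have "d - 1 \<le> card {b\<in>B. insert x (insert b e) \<in> F}" using contra unfolding weight_def by simp
  then obtain P where P: "P \<subseteq> {b\<in>B. insert x (insert b e) \<in> F}" "card P = d - 1" "finite P"
    by (rule obtain_subset_with_card_n)
  define h where "h b = insert x (insert b e)" for b
  have eq: "h b \<inter> B = {b}" if "b \<in> P" for b using that P B(2) fe unfolding h_def by auto
  have inj: "inj_on h P" using eq by (intro inj_onI) (metis singleton_inject)
  have "card P \<noteq> 0" "card P \<noteq> 1" using P d5 by auto
  then obtain b1 b2 where b: "b1 \<in> P" "b2 \<in> P" "b1 \<noteq> b2"
    by (metis card_1_singleton_iff card_eq_0_iff P(3) ex_in_conv insertI1 is_singletonI' is_singleton_altdef)
  show False
  proof (rule star_cluster[OF B, of "h ` P" "insert x e"])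
    show "card (h ` P) = d - 1" using card_image[OF inj] P(2) by simp
    have "B \<inter> \<Inter>(h ` P) \<subseteq> (h b1 \<inter> B) \<inter> (h b2 \<inter> B)" using b by auto
    then show "B \<inter> \<Inter>(h ` P) = {}" using eq b by auto
  qed (use P fe d5 dk in \<open>auto simp: h_def\<close>)
qed

text \<open>An edge of full weight alone violates \<open>weight_sum_less\<close>, so all its
  one-point extensions outside \<open>B\<close> and \<open>x\<close> are missing. There are at least
  \<open>n - 2 * k\<close>, hence at least \<open>n / 2\<close>, such extensions, while a missing
  set arises from at most \<open>k - 1\<close> edges. This gains a factor \<open>n\<close> over the
  bound for \<open>missing\<close>.\<close>

lemma card_full_weight:
  assumes B: "B \<in> F" "x \<notin> B" and M: "card (missing x) \<le> c * card V ^ (k - 2)" and n: "4 * k \<le> card V"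
  shows "card {e \<in> nsets (V - insert x B) (k - 2). weight x B e = d - 2} \<le> 2 * k * c * card V ^ (k - 3)"
proof -
  define n where "n = card V"
  define X where "X = {e \<in> nsets (V - insert x B) (k - 2). weight x B e = d - 2}"
  have fB: "finite B" "card B = k" "B \<subseteq> V" using F_D[OF B(1)] by auto
  have finX: "finite X" unfolding X_def using finV by (simp add: finite_imp_finite_nsets)
  have finM: "finite (missing x)" unfolding missing_def using finV by (simp add: finite_imp_finite_nsets)
  define P where "P = (SIGMA e:X. V - insert x B - e)"
  have in_M: "insert y e \<in> missing x" if "e \<in> X" "y \<in> V - insert x B - e" for e y
  proof (rule ccontr)
    assume c: "insert y e \<notin> missing x"
    have e: "e \<subseteq> V - insert x B" "finite e" "card e = k - 2" "weight x B e = d - 2"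
      using that unfolding X_def by (auto simp: nsets_def)
    have Y: "insert y e \<in> nsets (V - insert x B) (k - 1)" using that(2) e d5 dk by (auto simp: nsets_def)
    then have "insert x (insert y e) \<in> F" using c unfolding missing_def by (auto simp: nsets_def)
    then have "(\<Sum>e'\<in>nsets (insert y e) (k - 2). weight x B e') < d - 2" by (rule weight_sum_less[OF B Y])
    moreover have "weight x B e \<le> (\<Sum>e'\<in>nsets (insert y e) (k - 2). weight x B e')"
      using e by (intro member_le_sum) (auto simp: nsets_def finite_imp_finite_nsets)
    ultimately show False using e by simp
  qed
  have "card X * (n - 2 * k) \<le> card P"
  proof -
    have "card P = (\<Sum>e\<in>X. card (V - insert x B - e))"
      unfolding P_def using finX finV by (intro card_SigmaI) auto
    moreover have "(\<Sum>e\<in>X. n - 2 * k) \<le> (\<Sum>e\<in>X. card (V - insert x B - e))"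
    proof (rule sum_mono)
      fix e assume "e \<in> X"
      then have e: "finite e" "card e = k - 2" unfolding X_def by (auto simp: nsets_def)
      have "card (insert x B \<union> e) \<le> card (insert x B) + card e" by (rule card_Un_le)
      also have "\<dots> \<le> 2 * k" using fB e B(2) d5 dk by simp
      finally have "n - 2 * k \<le> card V - card (insert x B \<union> e)" unfolding n_def by simp
      also have "\<dots> \<le> card (V - (insert x B \<union> e))" using fB e by (intro diff_card_le_card_Diff) auto
      also have "V - (insert x B \<union> e) = V - insert x B - e" by auto
      finally show "n - 2 * k \<le> card (V - insert x B - e)" .
    qed
    ultimately show ?thesis by simp
  qed
  also have "card P \<le> card (SIGMA Y:missing x. Y)"
  proof (rule card_inj_on_le[where f = "\<lambda>(e, y). (insert y e, y)"])
    show "inj_on (\<lambda>(e, y). (insert y e, y)) P" unfolding P_def by (intro inj_onI) (clarsimp, metis insert_ident)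
    show "(\<lambda>(e, y). (insert y e, y)) ` P \<subseteq> (SIGMA Y:missing x. Y)"
      using in_M unfolding P_def by auto
    show "finite (SIGMA Y:missing x. Y)" using finM unfolding missing_def by (auto simp: nsets_def)
  qed
  also have "\<dots> = (\<Sum>Y\<in>missing x. card Y)"
    using finM unfolding missing_def by (intro card_SigmaI) (auto simp: nsets_def)
  also have "\<dots> = (\<Sum>Y\<in>missing x. k - 1)" unfolding missing_def by (intro sum.cong) (auto simp: nsets_def)
  also have "\<dots> \<le> k * (c * n ^ (k - 2))"
    using mult_mono[OF M, of "k - 1" k] by (simp add: n_def mult.commute)
  finally have 1: "card X * (n - 2 * k) \<le> k * (c * n ^ (k - 2))" .
  have "k - 2 = Suc (k - 3)" using d5 dk by simp
  then have "n ^ (k - 2) = n * n ^ (k - 3)" by simp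
  then have pow: "2 * (k * (c * n ^ (k - 2))) = n * (2 * k * c * n ^ (k - 3))" by simp
  have "n \<le> 2 * (n - 2 * k)" using n unfolding n_def by simp
  then have "n * card X \<le> 2 * (n - 2 * k) * card X" by (rule mult_right_mono) simp
  also have "\<dots> = 2 * (card X * (n - 2 * k))" by simp
  also have "\<dots> \<le> 2 * (k * (c * n ^ (k - 2)))" using 1 by (rule mult_left_mono) simp
  also note pow
  finally have "n * card X \<le> n * (2 * k * c * n ^ (k - 3))" .
  moreover have "0 < n" using n d5 dk unfolding n_def by simp
  ultimately show ?thesis unfolding X_def n_def by simp
qed

text \<open>Double counting of pairs \<open>(B, e)\<close> with \<open>insert b e\<close> missing for some \<open>b \<in> B\<close> of low degree
  in the sets avoiding \<open>x\<close>. Only boundedly many vertices have high degree there, so few \<open>B\<close> contain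
  three of them, while almost every \<open>e\<close> has at least three \<open>b \<in> B\<close> with \<open>insert b e\<close> missing.\<close>

lemma card_avoiding_le:
  assumes D: "card {A\<in>F. x \<notin> A} \<le> c * card V ^ (k - 2)" and M: "card (missing x) \<le> c * card V ^ (k - 2)"
    and U: "finite U" "card U \<le> u" and n: "4 * k \<le> card V"
    and q: "card V ^ (k - 2) + q * (2 * k * c * card V ^ (k - 3)) \<le> q * ((card V - (1 + k + u)) choose (k - 2))"
  shows "card {A\<in>F. x \<notin> A} \<le>
    card {S\<in>missing x. S \<inter> U = {}} + (q * k * k * c + u) ^ 3 * card V ^ (k - 3)"
proof -
  define n where "n = card V"
  define N where "N = n ^ (k - 2)"
  have npos: "0 < n" using n d5 dk unfolding n_def by simp
  then have Npos: "0 < N" unfolding N_def by simp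
  define \<D> where "\<D> = {A\<in>F. x \<notin> A}"
  define M' where "M' = {S\<in>missing x. S \<inter> U = {}}"
  have finD: "finite \<D>" unfolding \<D>_def using finF by simp
  have finM: "finite (missing x)" unfolding missing_def using finV by (simp add: finite_imp_finite_nsets)
  have fM': "finite M'" unfolding M'_def using finM by simp
  define deg where "deg b = card {A\<in>\<D>. b \<in> A}" for b
  \<comment> \<open>Chosen so that the constants cancel: each \<open>B\<close> yields at least
    \<open>N / q\<close> edges, and each missing set is hit through at most \<open>k\<close> points
    of degree at most \<open>N / T\<close>, which gives exactly
    \<open>card D' \<le> card M'\<close>.\<close>
  define T where "T = q * k"
  define Z where "Z = {b\<in>V. N < T * deg b}"
  have finZ: "finite Z" unfolding Z_def using finV by simp
  have sum_deg: "(\<Sum>b\<in>V. deg b) = k * card \<D>"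
  proof -
    have "(\<Sum>b\<in>V. deg b) = (\<Sum>b\<in>V. \<Sum>A\<in>\<D>. if b \<in> A then 1 else 0)"
      unfolding deg_def using finD by (intro sum.cong refl) (simp add: sum.If_cases Int_def)
    also have "\<dots> = (\<Sum>A\<in>\<D>. \<Sum>b\<in>V. if b \<in> A then 1 else 0)" by (rule sum.swap)
    also have "\<dots> = (\<Sum>A\<in>\<D>. k)"
    proof (rule sum.cong[OF refl])
      fix A assume "A \<in> \<D>"
      then have "V \<inter> A = A" "card A = k" using F_D unfolding \<D>_def by auto
      then show "(\<Sum>b\<in>V. if b \<in> A then 1 else 0) = k" using finV by (simp add: sum.If_cases)
    qed
    finally show ?thesis by simp
  qed
  have cZ: "card Z \<le> T * k * c"
  proof -
    have "card Z * N = (\<Sum>b\<in>Z. N)" by simp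
    also have "\<dots> \<le> (\<Sum>b\<in>Z. T * deg b)" by (rule sum_mono) (auto simp: Z_def)
    also have "\<dots> \<le> (\<Sum>b\<in>V. T * deg b)" by (rule sum_mono2[OF finV]) (auto simp: Z_def)
    also have "\<dots> = T * (k * card \<D>)" using sum_deg by (simp flip: sum_distrib_left)
    also have "\<dots> \<le> T * (k * (c * N))" using D unfolding \<D>_def N_def n_def by simp
    finally have "card Z * N \<le> (T * k * c) * N" by (simp add: mult.assoc)
    then show ?thesis using Npos by simp
  qed
  \<comment> \<open>\<open>U\<close> is excluded along with the high-degree points so that the
    missing sets found are disjoint from \<open>U\<close>; only such sets reduce the main term in
    \<open>card_decomposition\<close>.\<close>
  define W where "W = Z \<union> (U \<inter> V)"
  have W: "finite W" "W \<subseteq> V" using finZ U unfolding W_def Z_def by auto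
  have cW: "card W \<le> q * k * k * c + u"
  proof -
    have "card W \<le> card Z + card (U \<inter> V)" unfolding W_def by (rule card_Un_le)
    also have "card (U \<inter> V) \<le> card U" using U by (intro card_mono) auto
    finally show ?thesis using cZ U unfolding T_def by (simp add: mult.assoc)
  qed
  define D3 where "D3 = {A\<in>\<D>. 3 \<le> card (A \<inter> W)}"
  have "card D3 \<le> card (nsets W 3) * card V ^ (k - 3)"
  proof (rule card_containing_le[OF finV])
    show "finite (nsets W 3)" "nsets W 3 \<subseteq> nsets V 3" using W by (auto simp: finite_imp_finite_nsets nsets_def)
    show "D3 \<subseteq> {A \<in> nsets V k. \<exists>L\<in>nsets W 3. L \<subseteq> A}"
    proof
      fix A assume A: "A \<in> D3"
      then obtain L where "L \<subseteq> A \<inter> W" "card L = 3" "finite L"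
        unfolding D3_def using obtain_subset_with_card_n by blast
      then show "A \<in> {A \<in> nsets V k. \<exists>L\<in>nsets W 3. L \<subseteq> A}"
        using A F_sub unfolding D3_def \<D>_def by (auto simp: nsets_def)
    qed
  qed
  also have "\<dots> \<le> (q * k * k * c + u) ^ 3 * card V ^ (k - 3)"
    by (intro mult_right_mono order.trans[OF card_nsets_le[OF W(1)]] power_mono cW) auto
  finally have cD3: "card D3 \<le> (q * k * k * c + u) ^ 3 * card V ^ (k - 3)" .
  define D' where "D' = \<D> - D3"
  have finD': "finite D'" unfolding D'_def using finD by simp
  \<comment> \<open>Weight below \<open>d - 2\<close> is at most \<open>d - 3\<close>, hence at most
    \<open>k - 3\<close>: at least three points \<open>b\<close> of \<open>B\<close> make
    \<open>insert b e\<close> missing, and at most two of them lie in \<open>W\<close>.\<close>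
  define E where "E B = {e \<in> nsets (V - insert x (B \<union> U)) (k - 2). weight x B e \<noteq> d - 2}" for B
  have finE: "finite (E B)" for B unfolding E_def using finV by (simp add: finite_imp_finite_nsets)
  have cE: "N \<le> q * card (E B)" if "B \<in> D'" for B
  proof -
    have B: "B \<in> F" "x \<notin> B" using that unfolding D'_def \<D>_def by auto
    have fB: "finite B" "card B = k" "B \<subseteq> V" using F_D[OF B(1)] by auto
    have "card (insert x (B \<union> U)) \<le> Suc (card (B \<union> U))" by (rule card_insert_le_m1) simp_all
    also have "card (B \<union> U) \<le> card B + card U" by (rule card_Un_le)
    finally have "card (insert x (B \<union> U)) \<le> 1 + k + u" using fB U by simp
    then have "card V - (1 + k + u) \<le> card V - card (insert x (B \<union> U))" by simp
    also have "\<dots> \<le> card (V - insert x (B \<union> U))" using fB U by (intro diff_card_le_card_Diff) auto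
    finally have "(card V - (1 + k + u)) choose (k - 2) \<le> card (nsets (V - insert x (B \<union> U)) (k - 2))"
      by (simp add: binomial_right_mono)
    also have "\<dots> \<le> card (E B \<union> {e \<in> nsets (V - insert x B) (k - 2). weight x B e = d - 2})"
      using finE finV by (intro card_mono) (auto simp: E_def finite_imp_finite_nsets nsets_def)
    also have "\<dots> \<le> card (E B) + 2 * k * c * card V ^ (k - 3)"
      by (intro order.trans[OF card_Un_le] add_left_mono card_full_weight[OF B M n])
    finally have "q * ((card V - (1 + k + u)) choose (k - 2)) \<le> q * (card (E B) + 2 * k * c * card V ^ (k - 3))"
      by (rule mult_left_mono) simp_all
    then show ?thesis using q unfolding N_def n_def by (simp add: distrib_left)
  qed
  have wit: "\<exists>b. b \<in> B \<and> b \<notin> Z \<and> b \<in> V \<and> insert b e \<in> M'" if "B \<in> D'" "e \<in> E B" for B e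
  proof -
    have B: "B \<in> F" "x \<notin> B" "card (B \<inter> W) \<le> 2" using that unfolding D'_def \<D>_def D3_def by auto
    have fB: "finite B" "card B = k" "B \<subseteq> V" using F_D[OF B(1)] by auto
    have e: "e \<subseteq> V - insert x (B \<union> U)" "finite e" "card e = k - 2" "weight x B e \<noteq> d - 2"
      using that(2) unfolding E_def by (auto simp: nsets_def)
    have "weight x B e \<le> d - 2" by (rule weight_le[OF B(1,2)]) (use e in \<open>auto simp: nsets_def\<close>)
    then have w: "card {b\<in>B. insert x (insert b e) \<in> F} \<le> k - 3" using e(4) dk unfolding weight_def by simp
    have "\<exists>b\<in>B. b \<notin> W \<and> insert x (insert b e) \<notin> F"
    proof (rule ccontr)
      assume "\<not> ?thesis"
      then have "B \<subseteq> (B \<inter> W) \<union> {b\<in>B. insert x (insert b e) \<in> F}" by auto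
      then have "card B \<le> card ((B \<inter> W) \<union> {b\<in>B. insert x (insert b e) \<in> F})"
        using fB by (intro card_mono) auto
      also have "\<dots> \<le> 2 + (k - 3)" by (intro order.trans[OF card_Un_le] add_mono B w)
      finally show False using fB d5 dk by simp
    qed
    then obtain b where b: "b \<in> B" "b \<notin> W" "insert x (insert b e) \<notin> F" by blast
    then have "b \<in> V" "b \<notin> Z" "b \<notin> U" using fB unfolding W_def by auto
    moreover have "card (insert b e) = k - 1" using b(1) e(1,2,3) d5 dk by (subst card_insert_disjoint) auto
    then have "insert b e \<in> missing x"
      using b e B(2) fB(3) unfolding missing_def by (auto simp: nsets_def)
    ultimately show ?thesis using b e unfolding M'_def by auto
  qed
  define bb where "bb B e = (SOME b. b \<in> B \<and> b \<notin> Z \<and> b \<in> V \<and> insert b e \<in> M')" for B e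
  have bb: "bb B e \<in> B \<and> bb B e \<notin> Z \<and> bb B e \<in> V \<and> insert (bb B e) e \<in> M'" if "B \<in> D'" "e \<in> E B" for B e
    unfolding bb_def by (rule someI_ex[OF wit[OF that]])
  define Pr where "Pr = (SIGMA B:D'. E B)"
  define R where "R = (SIGMA S:M'. SIGMA b:S \<inter> V - Z. {A\<in>\<D>. b \<in> A})"
  have M'D: "finite S \<and> card S = k - 1" if "S \<in> M'" for S
    using that unfolding M'_def missing_def by (auto simp: nsets_def)
  have "card D' * N \<le> q * card Pr"
  proof -
    have "card D' * N = (\<Sum>B\<in>D'. N)" by simp
    also have "\<dots> \<le> (\<Sum>B\<in>D'. q * card (E B))" by (rule sum_mono[OF cE])
    also have "\<dots> = q * card Pr" unfolding Pr_def using finD' finE by (simp add: sum_distrib_left)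
    finally show ?thesis .
  qed
  also have "card Pr \<le> card R"
  \<comment> \<open>Recording the point \<open>bb B e\<close> with the missing set makes
    \<open>e\<close> recoverable; \<open>B\<close> is then one of the members through that
    low-degree point.\<close>
  proof (rule card_inj_on_le[where f = "\<lambda>(B, e). (insert (bb B e) e, bb B e, B)"])
    have "bb B e \<notin> e" if "B \<in> D'" "e \<in> E B" for B e
      using bb[OF that] that(2) unfolding E_def by (auto simp: nsets_def)
    then show "inj_on (\<lambda>(B, e). (insert (bb B e) e, bb B e, B)) Pr"
      unfolding Pr_def by (intro inj_onI) (clarsimp, metis insert_ident)
    show "(\<lambda>(B, e). (insert (bb B e) e, bb B e, B)) ` Pr \<subseteq> R"
      using bb unfolding Pr_def R_def D'_def by auto
    show "finite R" unfolding R_def using fM' M'D finD by (intro finite_SigmaI) auto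
  qed
  finally have "k * (card D' * N) \<le> k * (q * card R)" by (simp add: mult_left_mono)
  also have "\<dots> = T * card R" unfolding T_def by simp
  also have "card R = (\<Sum>S\<in>M'. \<Sum>b\<in>S \<inter> V - Z. deg b)"
    unfolding R_def deg_def using fM' M'D finD
    by (subst card_SigmaI) (auto intro!: finite_SigmaI sum.cong card_SigmaI)
  also have "T * \<dots> = (\<Sum>S\<in>M'. \<Sum>b\<in>S \<inter> V - Z. T * deg b)" by (simp add: sum_distrib_left)
  also have "\<dots> \<le> (\<Sum>S\<in>M'. k * N)"
  proof (rule sum_mono)
    fix S assume S: "S \<in> M'"
    have "(\<Sum>b\<in>S \<inter> V - Z. T * deg b) \<le> (\<Sum>b\<in>S \<inter> V - Z. N)" by (rule sum_mono) (auto simp: Z_def)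
    also have "\<dots> = card (S \<inter> V - Z) * N" by simp
    also have "\<dots> \<le> k * N"
    proof (rule mult_right_mono)
      have "card (S \<inter> V - Z) \<le> card S" using M'D[OF S] by (intro card_mono) auto
      then show "card (S \<inter> V - Z) \<le> k" using M'D[OF S] by simp
    qed simp
    finally show "(\<Sum>b\<in>S \<inter> V - Z. T * deg b) \<le> k * N" .
  qed
  also have "\<dots> = k * (card M' * N)" by simp
  finally have "card D' \<le> card M'" using Npos d5 dk by simp
  moreover have "card \<D> \<le> card D' + card D3"
    using finD card_Un_le[of D' D3] by (simp add: D'_def D3_def Un_absorb2)
  ultimately show ?thesis using cD3 unfolding M'_def \<D>_def by simp
qed

end

section \<open>Sparse multigraphs\<close>

text \<open>The counterpart of \<open>H_free\<close> for a multigraph given by its multiplicity function \<open>w\<close>.\<close>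

definition sparse :: "nat \<Rightarrow> nat \<Rightarrow> nat \<Rightarrow> 'a set \<Rightarrow> ('a set \<Rightarrow> nat) \<Rightarrow> bool" where
  "sparse r v q Q w \<longleftrightarrow> (\<forall>Y\<in>nsets Q v. (\<Sum>e\<in>nsets Y r. w e) < q)"

lemma size_eq_sum_count:
  assumes "finite X" "set_mset M \<subseteq> X" shows "size M = (\<Sum>e\<in>X. count M e)"
  unfolding size_multiset_overloaded_eq using assms
  by (intro sum.mono_neutral_left) (auto simp: count_eq_zero_iff)

lemma r_multigraph_edges:
  assumes "r_multigraph r (X, E)" shows "set_mset E \<subseteq> nsets X r"
proof
  fix e assume "e \<in># E"
  then have "finite X" "e \<subseteq> X" "card e = r" using assms unfolding r_multigraph_def by auto
  then show "e \<in> nsets X r" using finite_subset by (auto simp: nsets_def)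
qed

lemma H_free_iff_sparse:
  assumes "r_multigraph r (X, E)"
  shows "H_free r v q (X, E) \<longleftrightarrow> sparse r v q X (count E)"
proof
  assume free: "H_free r v q (X, E)"
  show "sparse r v q X (count E)"
    unfolding sparse_def
  proof (intro ballI, rule ccontr)
    fix Y assume Y: "Y \<in> nsets X v" and c: "\<not> (\<Sum>e\<in>nsets Y r. count E e) < q"
    have fY: "finite Y" "card Y = v" "Y \<subseteq> X" using Y by (auto simp: nsets_def)
    define M0 where "M0 = filter_mset (\<lambda>e. e \<in> nsets Y r) E"
    have "size M0 = (\<Sum>e\<in>nsets Y r. count M0 e)"
      by (rule size_eq_sum_count) (auto simp: M0_def fY finite_imp_finite_nsets)
    also have "\<dots> = (\<Sum>e\<in>nsets Y r. count E e)" by (rule sum.cong) (auto simp: M0_def)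
    finally have q: "q \<le> size M0" using c by simp
    \<comment> \<open>\<open>H_family\<close> asks for exactly \<open>q\<close> edges, so an
      overfull multiset is cut down to size \<open>q\<close>.\<close>
    obtain xs where xs: "mset xs = M0" using ex_mset by blast
    define M where "M = mset (take q xs)"
    have "M \<subseteq># M0" unfolding M_def xs[symmetric]
      by (metis append_take_drop_id mset_append mset_subset_eq_add_left)
    moreover have "M0 \<subseteq># E" unfolding M0_def by simp
    ultimately have sub: "M \<subseteq># E" by (rule subset_mset.order_trans)
    have "set_mset M \<subseteq> nsets Y r"
      using set_mset_mono[OF \<open>M \<subseteq># M0\<close>] unfolding M0_def by auto
    note sub = sub this
    have "size M = q" using q xs unfolding M_def by (metis length_take min.absorb2 size_mset)
    then have "(Y, M) \<in> H_family r v q"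
      using sub fY unfolding H_family_def r_multigraph_def by (auto simp: nsets_def)
    moreover have "sub_multigraph (Y, M) (X, E)" using fY sub unfolding sub_multigraph_def by auto
    ultimately show False using free unfolding H_free_def by blast
  qed
next
  assume sp: "sparse r v q X (count E)"
  show "H_free r v q (X, E)"
    unfolding H_free_def
  proof
    assume "\<exists>H\<in>H_family r v q. sub_multigraph H (X, E)"
    then obtain W M where WM: "r_multigraph r (W, M)" "card W = v" "size M = q" "W \<subseteq> X" "M \<subseteq># E"
      unfolding H_family_def sub_multigraph_def by auto
    have fW: "finite W" "\<And>e. e \<in># M \<Longrightarrow> e \<in> nsets W r"
      using WM(1) r_multigraph_edges[OF WM(1)] unfolding r_multigraph_def by auto
    have "q = (\<Sum>e\<in>nsets W r. count M e)"
      using size_eq_sum_count[of "nsets W r" M] fW WM(3) by (auto simp: finite_imp_finite_nsets)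
    also have "\<dots> \<le> (\<Sum>e\<in>nsets W r. count E e)" using WM(5) by (intro sum_mono mset_subset_eq_count)
    also have "\<dots> < q" using sp WM(2,4) fW unfolding sparse_def by (auto simp: nsets_def)
    finally show False by simp
  qed
qed

lemma sparse_weight_less:
  assumes "sparse r v q Q w" "finite Q" "r \<le> v" "v \<le> card Q" "e \<in> nsets Q r"
  shows "w e < q"
proof -
  have "e \<subseteq> Q" "card e = r" "finite e" using assms(5) by (auto simp: nsets_def)
  then obtain Y where Y: "e \<subseteq> Y" "Y \<subseteq> Q" "card Y = v"
    using exists_subset_between[of e v Q] assms(2,3,4) by auto
  have fY: "finite Y" using Y(2) assms(2) finite_subset by blast
  have "w e \<le> (\<Sum>e\<in>nsets Y r. w e)"
    using Y fY assms(5) by (intro member_le_sum) (auto simp: nsets_def finite_imp_finite_nsets)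
  also have "\<dots> < q" using assms(1) Y fY unfolding sparse_def by (auto simp: nsets_def)
  finally show ?thesis .
qed

lemma finite_EX_set:
  assumes "r \<le> v" "v \<le> m"
  shows "finite {size E | E. r_multigraph r ({1..m}, E) \<and> H_free r v q ({1..m::nat}, E)}"
proof (rule finite_subset)
  show "{size E | E. r_multigraph r ({1..m}, E) \<and> H_free r v q ({1..m::nat}, E)} \<subseteq> {..(m choose r) * q}"
  proof
    fix s assume "s \<in> {size E | E. r_multigraph r ({1..m}, E) \<and> H_free r v q ({1..m::nat}, E)}"
    then obtain E where s: "s = size E" and E: "r_multigraph r ({1..m}, E)" "H_free r v q ({1..m::nat}, E)"
      by blast
    have sp: "sparse r v q {1..m} (count E)" using E H_free_iff_sparse by blast
    have "set_mset E \<subseteq> nsets {1..m} r" by (rule r_multigraph_edges[OF E(1)])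
    then have "size E = (\<Sum>e\<in>nsets {1..m} r. count E e)"
      by (intro size_eq_sum_count finite_imp_finite_nsets) auto
    also have "\<dots> \<le> (\<Sum>e\<in>nsets {1..m} r. q)"
      using sparse_weight_less[OF sp] assms by (intro sum_mono less_imp_le) auto
    finally show "s \<in> {..(m choose r) * q}" using s by simp
  qed
qed simp

lemma sparse_reindex:
  assumes h: "bij_betw h X Q"
  shows "sparse r v q Q w \<Longrightarrow> sparse r v q X (\<lambda>e. w (h ` e))"
    and "(\<Sum>e\<in>nsets X r. w (h ` e)) = (\<Sum>e\<in>nsets Q r. w e)"
proof -
  show "(\<Sum>e\<in>nsets X r. w (h ` e)) = (\<Sum>e\<in>nsets Q r. w e)"
    by (rule sum.reindex_bij_betw[OF bij_betw_nsets[OF h]])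
  assume sp: "sparse r v q Q w"
  show "sparse r v q X (\<lambda>e. w (h ` e))"
    unfolding sparse_def
  proof
    fix Y assume Y: "Y \<in> nsets X v"
    then have "bij_betw h Y (h ` Y)" using h by (auto simp: nsets_def bij_betw_def inj_on_subset)
    then have "(\<Sum>e\<in>nsets Y r. w (h ` e)) = (\<Sum>e\<in>nsets (h ` Y) r. w e)"
      by (rule sum.reindex_bij_betw[OF bij_betw_nsets])
    also have "\<dots> < q" using sp bij_betwE[OF bij_betw_nsets[OF h]] Y unfolding sparse_def by blast
    finally show "(\<Sum>e\<in>nsets Y r. w (h ` e)) < q" .
  qed
qed

text \<open>The interface to \<open>EX_multi\<close>: a weight function on any finite ground set is
  relabelled to \<open>{1..card Q}\<close> and turned into a multiset.\<close>

lemma sum_le_EX_multi: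
  fixes Q :: "'a set"
  assumes "r \<le> v" "v \<le> card Q" and Q: "finite Q" and sp: "sparse r v q Q w"
  shows "(\<Sum>e\<in>nsets Q r. w e) \<le> EX_multi r (card Q) v q"
proof -
  define X where "X = {1..card Q}"
  obtain h where h: "bij_betw h X Q"
    using finite_same_card_bij[of X Q] Q unfolding X_def by auto
  define E where "E = (\<Sum>e\<in>nsets X r. replicate_mset (w (h ` e)) e)"
  have finX: "finite X" unfolding X_def by simp
  have fin: "finite (nsets X r)" by (rule finite_imp_finite_nsets[OF finX])
  have cE: "count E e = (if e \<in> nsets X r then w (h ` e) else 0)" for e
    unfolding E_def count_sum using fin by (simp add: sum.delta')
  have inE: "e \<in> nsets X r" if "e \<in># E" for e
    using that cE[of e] by (metis count_eq_zero_iff)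
  have rE: "r_multigraph r (X, E)" unfolding r_multigraph_def using inE finX by (auto simp: nsets_def)
  have "sparse r v q X (count E)"
    unfolding sparse_def
  proof
    fix Y assume Y: "Y \<in> nsets X v"
    have "(\<Sum>e\<in>nsets Y r. count E e) = (\<Sum>e\<in>nsets Y r. w (h ` e))"
      using Y by (intro sum.cong) (auto simp: cE nsets_def)
    also have "\<dots> < q" using sparse_reindex(1)[OF h sp] Y unfolding sparse_def by blast
    finally show "(\<Sum>e\<in>nsets Y r. count E e) < q" .
  qed
  then have "H_free r v q (X, E)" using H_free_iff_sparse[OF rE] by blast
  then have "size E \<le> EX_multi r (card Q) v q"
    unfolding EX_multi_def using rE finite_EX_set[OF assms(1,2)] unfolding X_def by (intro Max_ge) auto
  moreover have "size E = (\<Sum>e\<in>nsets Q r. w e)"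
  proof -
    have "size E = (\<Sum>e\<in>nsets X r. count E e)" using inE fin by (intro size_eq_sum_count) auto
    also have "\<dots> = (\<Sum>e\<in>nsets X r. w (h ` e))" by (rule sum.cong) (auto simp: cE)
    also have "\<dots> = (\<Sum>e\<in>nsets Q r. w e)" by (rule sparse_reindex(2)[OF h])
    finally show ?thesis .
  qed
  ultimately show ?thesis by simp
qed

lemma EX_multi_attained:
  fixes Q :: "'a set"
  assumes "r \<le> v" "v \<le> card Q" "1 \<le> q" and Q: "finite Q"
  obtains w where "sparse r v q Q w" "(\<Sum>e\<in>nsets Q r. w e) = EX_multi r (card Q) v q"
proof -
  define m where "m = card Q"
  obtain h where h: "bij_betw h Q {1..m}"
    using finite_same_card_bij[of Q "{1..m}"] Q unfolding m_def by auto
  let ?S = "{size E | E. r_multigraph r ({1..m}, E) \<and> H_free r v q ({1..m::nat}, E)}"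
  have r0: "r_multigraph r ({1..m}, {#})" unfolding r_multigraph_def by auto
  have "H_free r v q ({1..m}, {#})"
    using assms(3) unfolding H_free_iff_sparse[OF r0] sparse_def by auto
  then have "?S \<noteq> {}" using r0 by blast
  then have "Max ?S \<in> ?S" using finite_EX_set[OF assms(1,2)] unfolding m_def by (intro Max_in)
  then obtain E where E: "r_multigraph r ({1..m}, E)" "H_free r v q ({1..m::nat}, E)" "size E = EX_multi r m v q"
    unfolding EX_multi_def by auto
  have "set_mset E \<subseteq> nsets {1..m} r" by (rule r_multigraph_edges[OF E(1)])
  then have "size E = (\<Sum>e\<in>nsets {1..m} r. count E e)"
    by (intro size_eq_sum_count finite_imp_finite_nsets) auto
  moreover have "sparse r v q {1..m} (count E)" using E H_free_iff_sparse by blast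
  ultimately show ?thesis
    using that[of "\<lambda>e. count E (h ` e)"] sparse_reindex[OF h] E(3) unfolding m_def by metis
qed

section \<open>Averaging over subsets and the limiting edge density\<close>

lemma card_nsets_supersets:
  assumes "finite W" "e \<subseteq> W" "card e \<le> m"
  shows "card {Q\<in>nsets W m. e \<subseteq> Q} = (card W - card e) choose (m - card e)"
proof -
  have fe: "finite e" using assms finite_subset by blast
  have "bij_betw (\<lambda>Q. Q - e) {Q\<in>nsets W m. e \<subseteq> Q} (nsets (W - e) (m - card e))"
  proof (rule bij_betw_byWitness[where f' = "\<lambda>R. R \<union> e"])
    show "(\<lambda>Q. Q - e) ` {Q\<in>nsets W m. e \<subseteq> Q} \<subseteq> nsets (W - e) (m - card e)"
      using fe by (auto simp: nsets_def card_Diff_subset)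
    show "(\<lambda>R. R \<union> e) ` nsets (W - e) (m - card e) \<subseteq> {Q\<in>nsets W m. e \<subseteq> Q}"
    proof (intro image_subsetI)
      fix R assume R: "R \<in> nsets (W - e) (m - card e)"
      then have "R \<inter> e = {}" "finite R" by (auto simp: nsets_def)
      then have "card (R \<union> e) = card R + card e" using fe by (intro card_Un_disjoint) auto
      then show "R \<union> e \<in> {Q\<in>nsets W m. e \<subseteq> Q}" using R assms fe by (auto simp: nsets_def)
    qed
  qed (auto simp: nsets_def)
  then have "card {Q\<in>nsets W m. e \<subseteq> Q} = card (nsets (W - e) (m - card e))" by (rule bij_betw_same_card)
  then show ?thesis using card_Diff_subset[OF fe assms(2)] by simp
qed

lemma sum_over_subsets:
  fixes w :: "'a set \<Rightarrow> nat"
  assumes "finite W" "r \<le> m"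
  shows "(\<Sum>Q\<in>nsets W m. \<Sum>e\<in>nsets Q r. w e) = ((card W - r) choose (m - r)) * (\<Sum>e\<in>nsets W r. w e)"
proof -
  have fin: "finite (nsets W j)" for j by (rule finite_imp_finite_nsets[OF assms(1)])
  have "(\<Sum>Q\<in>nsets W m. \<Sum>e\<in>nsets Q r. w e) = (\<Sum>Q\<in>nsets W m. \<Sum>e\<in>nsets W r. if e \<subseteq> Q then w e else 0)"
  proof (rule sum.cong[OF refl])
    fix Q assume "Q \<in> nsets W m"
    then have "nsets W r \<inter> {e. e \<subseteq> Q} = nsets Q r" by (auto simp: nsets_def)
    then show "(\<Sum>e\<in>nsets Q r. w e) = (\<Sum>e\<in>nsets W r. if e \<subseteq> Q then w e else 0)"
      using fin by (simp add: sum.If_cases)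
  qed
  also have "\<dots> = (\<Sum>e\<in>nsets W r. \<Sum>Q\<in>nsets W m. if e \<subseteq> Q then w e else 0)" by (rule sum.swap)
  also have "\<dots> = (\<Sum>e\<in>nsets W r. ((card W - r) choose (m - r)) * w e)"
  proof (rule sum.cong[OF refl])
    fix e assume "e \<in> nsets W r"
    then have e: "e \<subseteq> W" "card e = r" by (auto simp: nsets_def)
    have "(\<Sum>Q\<in>nsets W m. if e \<subseteq> Q then w e else 0) = card {Q\<in>nsets W m. e \<subseteq> Q} * w e"
      using fin by (simp add: sum.If_cases Int_def)
    then show "(\<Sum>Q\<in>nsets W m. if e \<subseteq> Q then w e else 0) = ((card W - r) choose (m - r)) * w e"
      using card_nsets_supersets[OF assms(1) e(1), of m] e assms(2) by simp
  qed
  finally show ?thesis by (simp add: sum_distrib_left)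
qed

text \<open>The averaging argument of Katona, Nemetz and Simonovits: restrictions of an extremal
  multigraph to m-sets are sparse, and every edge lies in equally many of them.\<close>

lemma EX_multi_density_mono:
  assumes "r \<le> v" "v \<le> m" "m \<le> N" "1 \<le> q"
  shows "real (EX_multi r N v q) / real (N choose r) \<le> real (EX_multi r m v q) / real (m choose r)"
proof -
  obtain w where w: "sparse r v q {1..N} w" "(\<Sum>e\<in>nsets {1..N} r. w e) = EX_multi r N v q"
    using EX_multi_attained[of r v "{1..N}" q] assms by auto
  have "((N - r) choose (m - r)) * EX_multi r N v q = (\<Sum>Q\<in>nsets {1..N} m. \<Sum>e\<in>nsets Q r. w e)"
    using sum_over_subsets[of "{1..N}" r m w] w assms by simp
  also have "\<dots> \<le> (\<Sum>Q\<in>nsets {1..N} m. EX_multi r m v q)"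
  proof (rule sum_mono)
    fix Q assume Q: "Q \<in> nsets {1..N} m"
    then have "sparse r v q Q w" using w(1) nsets_mono unfolding sparse_def by (auto simp: nsets_def)
    then show "(\<Sum>e\<in>nsets Q r. w e) \<le> EX_multi r m v q"
      using sum_le_EX_multi[of r v Q q w] Q assms by (auto simp: nsets_def)
  qed
  also have "\<dots> = (N choose m) * EX_multi r m v q" by simp
  finally have "real ((N - r) choose (m - r)) * real (EX_multi r N v q) \<le> real (N choose m) * real (EX_multi r m v q)"
    by (metis of_nat_le_iff of_nat_mult)
  moreover have "real (N choose m) * real (m choose r) = real (N choose r) * real ((N - r) choose (m - r))"
    using choose_mult[of r m N] assms by (metis le_trans of_nat_mult)
  moreover have "0 < real (N choose m)" "0 < real (m choose r)" "0 < real (N choose r)" "0 < real ((N - r) choose (m - r))"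
    using assms by auto
  note pos = this
  ultimately have eq: "real (N choose m) * real (m choose r) = real (N choose r) * real ((N - r) choose (m - r))"
    and le: "real ((N - r) choose (m - r)) * real (EX_multi r N v q) \<le> real (N choose m) * real (EX_multi r m v q)"
    by blast+
  have "real ((N - r) choose (m - r)) * (real (EX_multi r N v q) * real (m choose r))
      \<le> (real (N choose m) * real (EX_multi r m v q)) * real (m choose r)"
    using mult_right_mono[OF le, of "real (m choose r)"] by (simp add: mult.assoc)
  also have "\<dots> = (real (N choose m) * real (m choose r)) * real (EX_multi r m v q)" by simp
  also have "\<dots> = real ((N - r) choose (m - r)) * (real (EX_multi r m v q) * real (N choose r))"
    unfolding eq by simp
  finally have "real (EX_multi r N v q) * real (m choose r) \<le> real (EX_multi r m v q) * real (N choose r)"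
    using pos(4) by simp
  then show ?thesis using pos by (simp add: divide_simps mult.commute)
qed

lemma choose_ge_power:
  assumes "2 * s + 2 * r \<le> n"
  shows "n ^ r \<le> (2 * r) ^ r * ((n - s) choose r)"
proof (cases "r = 0")
  case False
  have r: "r \<le> n - s" using assms by simp
  have "real n \<le> 2 * real (n - s)" using assms by simp
  then have "real n / (2 * real r) \<le> real (n - s) / real r" using False by (simp add: field_simps)
  then have "(real n / (2 * real r)) ^ r \<le> (real (n - s) / real r) ^ r" by (intro power_mono) auto
  also have "\<dots> \<le> real ((n - s) choose r)" using binomial_ge_n_over_k_pow_k[OF r] by simp
  finally have "real n ^ r \<le> (2 * real r) ^ r * real ((n - s) choose r)"
    using False by (simp add: power_divide field_simps)
  then have "real (n ^ r) \<le> real ((2 * r) ^ r * ((n - s) choose r))" by simp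
  then show ?thesis by (simp only: of_nat_le_iff)
qed simp

text \<open>Supersaturation by averaging over the subsets of a large constant size \<open>m\<close>: all but a
  fraction \<open>O(1/N)\<close> of them contain no violating set.\<close>

lemma sum_le_EX_multi_approx:
  fixes C K :: nat and \<delta> :: real
  assumes "1 \<le> r" "r < v" "1 \<le> q" "0 < \<delta>"
  shows "\<exists>N0. \<forall>N\<ge>N0. \<forall>W :: 'a set. \<forall>w. finite W \<longrightarrow> card W = N \<longrightarrow> (\<forall>e. w e \<le> K) \<longrightarrow>
     card {Y\<in>nsets W v. q \<le> (\<Sum>e\<in>nsets Y r. w e)} \<le> C * N ^ (v - 1) \<longrightarrow>
     real (\<Sum>e\<in>nsets W r. w e) \<le> real (EX_multi r N v q) + \<delta> * real N ^ r"
proof -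
  \<comment> \<open>Starting the index at \<open>v\<close> keeps to the range where the maximum in
    \<open>EX_multi\<close> is meaningful.\<close>
  define dens where "dens i = real (EX_multi r (v + i) v q) / real ((v + i) choose r)" for i
  have "decseq dens" unfolding dens_def decseq_def using assms
    by (intro allI impI EX_multi_density_mono) auto
  then obtain p where p: "dens \<longlonglongrightarrow> p" "\<And>i. p \<le> dens i"
    using decseq_convergent[of dens 0] unfolding dens_def by auto
  have "\<forall>\<^sub>F i in sequentially. dens i < p + \<delta> / 2"
    using order_tendstoD(2)[OF p(1)] assms(4) by simp
  then obtain i where i: "dens i < p + \<delta> / 2" by (auto simp: eventually_sequentially)
  define m where "m = v + i"
  have m: "v \<le> m" "r < m" using assms unfolding m_def by auto
  \<comment> \<open>The loss from bad m-sets: at most \<open>C * N ^ (m - 1)\<close> of them, each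
    of total weight at most \<open>K * (m choose r)\<close>, divided by the number of m-sets over
    one edge, which \<open>choose_ge_power\<close> bounds below by \<open>N ^ (m - r)\<close> up to
    a constant. What remains is \<open>\<mu> * N ^ (r - 1)\<close>.\<close>
  define \<mu> where "\<mu> = real (C * K * (m choose r) * (2 * (m - r)) ^ (m - r))"
  define N0 where "N0 = max (2 * r + 2 * m) (nat \<lceil>2 * \<mu> / \<delta>\<rceil>)"
  show ?thesis
  proof (intro exI[of _ N0] allI impI)
    fix N and W :: "'a set" and w
    assume N: "N0 \<le> N" and W: "finite W" "card W = N" and wK: "\<forall>e. w e \<le> K"
      and viol: "card {Y\<in>nsets W v. q \<le> (\<Sum>e\<in>nsets Y r. w e)} \<le> C * N ^ (v - 1)"
    have Nm: "2 * r + 2 * m \<le> N" using N unfolding N0_def by simp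
    then have Npos: "0 < N" "m \<le> N" "v \<le> N" using m by auto
    define V where "V = {Y\<in>nsets W v. q \<le> (\<Sum>e\<in>nsets Y r. w e)}"
    define \<B> where "\<B> = {Q\<in>nsets W m. \<exists>Y\<in>V. Y \<subseteq> Q}"
    have fin: "finite (nsets W j)" for j by (rule finite_imp_finite_nsets[OF W(1)])
    have cB: "card \<B> \<le> C * N ^ (m - 1)"
    proof -
      have "card \<B> \<le> card V * card W ^ (m - v)"
        by (rule card_containing_le[OF W(1)]) (use fin in \<open>auto simp: V_def \<B>_def\<close>)
      also have "\<dots> \<le> (C * N ^ (v - 1)) * N ^ (m - v)"
        using viol unfolding V_def W(2) by (rule mult_right_mono) simp
      also have "\<dots> = C * N ^ (m - 1)" using m assms(2) by (simp add: mult.assoc flip: power_add)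
      finally show ?thesis .
    qed
    have "((N - r) choose (m - r)) * (\<Sum>e\<in>nsets W r. w e) = (\<Sum>Q\<in>nsets W m. \<Sum>e\<in>nsets Q r. w e)"
      using sum_over_subsets[OF W(1), of r m w] W m by simp
    also have "\<dots> \<le> (\<Sum>Q\<in>nsets W m. EX_multi r m v q + (if Q \<in> \<B> then K * (m choose r) else 0))"
    proof (rule sum_mono)
      fix Q assume Q: "Q \<in> nsets W m"
      then have fQ: "finite Q" "card Q = m" by (auto simp: nsets_def)
      show "(\<Sum>e\<in>nsets Q r. w e) \<le> EX_multi r m v q + (if Q \<in> \<B> then K * (m choose r) else 0)"
      proof (cases "Q \<in> \<B>")
        case True
        have "(\<Sum>e\<in>nsets Q r. w e) \<le> (\<Sum>e\<in>nsets Q r. K)" using wK by (intro sum_mono) auto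
        then show ?thesis using True fQ by (simp add: mult.commute)
      next
        case False
        have "sparse r v q Q w"
          unfolding sparse_def
        proof (rule ballI, rule ccontr)
          fix Y assume Y: "Y \<in> nsets Q v" "\<not> (\<Sum>e\<in>nsets Y r. w e) < q"
          then have "Y \<in> V" using Q unfolding V_def by (auto simp: nsets_def)
          then show False using False Q Y unfolding \<B>_def by (auto simp: nsets_def)
        qed
        then show ?thesis using sum_le_EX_multi[of r v Q q w] fQ m assms False by simp
      qed
    qed
    also have "\<dots> = (N choose m) * EX_multi r m v q + card \<B> * (K * (m choose r))"
    proof -
      have "nsets W m \<inter> {Q. Q \<in> \<B>} = \<B>" unfolding \<B>_def by auto
      then show ?thesis using fin W by (simp add: sum.distrib sum.If_cases)
    qed
    also have "\<dots> \<le> (N choose m) * EX_multi r m v q + (C * N ^ (m - 1)) * (K * (m choose r))"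
      using cB by (intro add_left_mono mult_right_mono) auto
    finally have main: "((N - r) choose (m - r)) * (\<Sum>e\<in>nsets W r. w e)
        \<le> (N choose m) * EX_multi r m v q + (C * N ^ (m - 1)) * (K * (m choose r))" .
    define c where "c = real ((N - r) choose (m - r))"
    define S where "S = real (\<Sum>e\<in>nsets W r. w e)"
    have cpos: "0 < c" unfolding c_def using Npos m by simp
    have mpos: "0 < real (m choose r)" using m by simp
    have idn: "real (N choose m) * real (m choose r) = real (N choose r) * c"
      unfolding c_def using choose_mult[of r m N] m Npos by (metis less_imp_le of_nat_mult)
    have "c * S \<le> real (N choose m) * real (EX_multi r m v q) + real (C * N ^ (m - 1)) * real (K * (m choose r))"
      using main unfolding c_def S_def by (metis of_nat_add of_nat_le_iff of_nat_mult)
    also have "real (N choose m) * real (EX_multi r m v q) = c * (real (N choose r) * dens i)"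
      using idn mpos unfolding dens_def m_def[symmetric] by (simp add: field_simps)
    also have "real (C * N ^ (m - 1)) * real (K * (m choose r)) \<le> c * (\<mu> * real N ^ (r - 1))"
    proof -
      have "N ^ (m - r) \<le> (2 * (m - r)) ^ (m - r) * ((N - r) choose (m - r))"
        by (rule choose_ge_power) (use Nm in auto)
      then have "real N ^ (m - r) \<le> real ((2 * (m - r)) ^ (m - r)) * c" unfolding c_def
        by (metis of_nat_le_iff of_nat_mult of_nat_power)
      then have "real (C * K * (m choose r)) * real N ^ (r - 1) * real N ^ (m - r) \<le>
          real (C * K * (m choose r)) * real N ^ (r - 1) * (real ((2 * (m - r)) ^ (m - r)) * c)"
        by (rule mult_left_mono) simp
      moreover have "real N ^ (m - 1) = real N ^ (r - 1) * real N ^ (m - r)"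
        using assms(1) m by (simp flip: power_add)
      ultimately show ?thesis unfolding \<mu>_def by (simp add: mult_ac)
    qed
    finally have "c * S \<le> c * (real (N choose r) * dens i + \<mu> * real N ^ (r - 1))" by (simp add: distrib_left)
    then have "S \<le> real (N choose r) * dens i + \<mu> * real N ^ (r - 1)" using cpos by simp
    also have "real (N choose r) * dens i \<le> real (N choose r) * (p + \<delta> / 2)"
      using i by (intro mult_left_mono) auto
    also have "\<dots> = real (N choose r) * p + real (N choose r) * (\<delta> / 2)" by (simp add: distrib_left)
    also have "real (N choose r) * p \<le> real (EX_multi r N v q)"
    proof -
      \<comment> \<open>The limit of the decreasing densities lies below the density at
        \<open>N\<close>, so the bound obtained from the constant size \<open>m\<close> becomes one
        in terms of \<open>EX_multi\<close> at \<open>N\<close>.\<close>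
      have "p \<le> real (EX_multi r N v q) / real (N choose r)"
        using p(2)[of "N - v"] Npos unfolding dens_def by simp
      moreover have "0 < real (N choose r)" using Npos m by simp
      ultimately show ?thesis by (simp add: field_simps)
    qed
    also have "real (N choose r) * (\<delta> / 2) \<le> real N ^ r * (\<delta> / 2)"
      using choose_le_power[of N r] assms(4)
      by (intro mult_right_mono) (metis of_nat_le_iff of_nat_power, simp)
    also have "\<mu> * real N ^ (r - 1) \<le> real N ^ r * (\<delta> / 2)"
    proof -
      have "2 * \<mu> / \<delta> \<le> real N" using N unfolding N0_def by linarith
      then have "\<mu> \<le> real N * (\<delta> / 2)" using assms(4) by (simp add: field_simps)
      then have "\<mu> * real N ^ (r - 1) \<le> (real N * (\<delta> / 2)) * real N ^ (r - 1)" by (rule mult_right_mono) simp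
      also have "\<dots> = real N ^ r * (\<delta> / 2)" using assms(1) by (cases r) auto
      finally show ?thesis .
    qed
    finally show "real (\<Sum>e\<in>nsets W r. w e) \<le> real (EX_multi r N v q) + \<delta> * real N ^ r"
      unfolding S_def by (simp add: algebra_simps)
  qed
qed

text \<open>The complete \<open>r\<close>-partite hypergraph with the residue classes modulo \<open>r\<close> as parts:
  \<open>r + 1\<close> vertices that meet every part meet exactly one part twice, so they span two edges.\<close>

lemma EX_multi_ge_partite:
  assumes "1 \<le> r" "3 \<le> q" "r + 1 \<le> N"
  shows "(N div r) ^ r \<le> EX_multi r N (r + 1) q"
proof -
  define w where "w e = (if inj_on (\<lambda>x. x mod r) e then 1 else 0 :: nat)" for e :: "nat set"
  have "sparse r (r + 1) q {..<N} w"
    unfolding sparse_def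
  proof
    fix Y assume Y: "Y \<in> nsets {..<N} (r + 1)"
    have fY: "finite Y" "card Y = r + 1" using Y by (auto simp: nsets_def)
    define T where "T = {e\<in>nsets Y r. inj_on (\<lambda>x. x mod r) e}"
    have fin: "finite (nsets Y r)" by (rule finite_imp_finite_nsets[OF fY(1)])
    have "(\<Sum>e\<in>nsets Y r. w e) = card T"
      unfolding w_def T_def using fin by (simp add: sum.If_cases Int_def)
    also have "card T \<le> 2"
    proof (cases "T = {}")
      case False
      then obtain e0 where e0: "e0 \<subseteq> Y" "card e0 = r" "finite e0" "inj_on (\<lambda>x. x mod r) e0"
        unfolding T_def by (auto simp: nsets_def)
      have minus: "\<exists>z\<in>Y. e = Y - {z}" if "e \<in> nsets Y r" for e
      proof -
        have e: "e \<subseteq> Y" "card e = r" "finite e" using that by (auto simp: nsets_def)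
        then have "card (Y - e) = 1" using fY by (simp add: card_Diff_subset)
        then obtain z where "Y - e = {z}" by (rule card_1_singletonE)
        then show ?thesis using e by (intro bexI[of _ z]) auto
      qed
      obtain y where y: "y \<in> Y" "e0 = Y - {y}" using minus[of e0] e0 by (auto simp: nsets_def)
      have "(\<lambda>x. x mod r) ` e0 = {..<r}"
        using assms(1) e0 by (intro card_subset_eq) (auto simp: card_image)
      moreover have "y mod r \<in> {..<r}" using assms(1) by simp
      ultimately obtain y1 where y1: "y1 \<in> e0" "y1 mod r = y mod r" by (metis imageE)
      \<comment> \<open>\<open>y\<close> and \<open>y1\<close> share a residue class, so an edge
        omits one of them; having \<open>r\<close> of the \<open>r + 1\<close> points of
        \<open>Y\<close>, it omits nothing else.\<close>
      have "T \<subseteq> {Y - {y}, Y - {y1}}"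
      proof
        fix e assume e: "e \<in> T"
        then obtain z where z: "z \<in> Y" "e = Y - {z}" using minus unfolding T_def by auto
        have "z = y \<or> z = y1"
        proof (rule ccontr)
          assume "\<not> ?thesis"
          then have "y \<in> e" "y1 \<in> e" "y \<noteq> y1" using z y y1 by auto
          then show False using e y1(2) unfolding T_def inj_on_def by auto
        qed
        then show "e \<in> {Y - {y}, Y - {y1}}" using z by auto
      qed
      then have "card T \<le> card {Y - {y}, Y - {y1}}" by (intro card_mono) auto
      also have "\<dots> \<le> 2" by (simp add: card_insert_if)
      finally show ?thesis .
    qed simp
    finally show "(\<Sum>e\<in>nsets Y r. w e) < q" using assms(2) by simp
  qed
  then have "(\<Sum>e\<in>nsets {..<N} r. w e) \<le> EX_multi r N (r + 1) q"
    using sum_le_EX_multi[of r "r + 1" "{..<N}" q w] assms by simp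
  moreover have "(\<Sum>e\<in>nsets {..<N} r. w e) = card {e\<in>nsets {..<N} r. inj_on (\<lambda>x. x mod r) e}"
    unfolding w_def by (simp add: sum.If_cases Int_def finite_imp_finite_nsets)
  moreover have "(N div r) ^ r \<le> card {e\<in>nsets {..<N} r. inj_on (\<lambda>x. x mod r) e}"
  proof -
    \<comment> \<open>The edge that takes one vertex from each residue class \<open>i\<close>, with
      quotient \<open>f i\<close>.\<close>
    define \<phi> where "\<phi> f = (\<lambda>i. i + r * f i) ` {..<r}" for f :: "nat \<Rightarrow> nat"
    let ?P = "PiE {..<r} (\<lambda>_. {..<N div r})"
    have digit: "i = j" if "i < r" "j < r" "i + r * a = j + r * b" for i j a b :: nat
      using that by (metis mod_less mod_mult_self2)
    have inj1: "inj_on (\<lambda>i. i + r * f i) {..<r}" for f :: "nat \<Rightarrow> nat"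
    proof (rule inj_onI)
      fix i j assume ij: "i \<in> {..<r}" "j \<in> {..<r}" "i + r * f i = j + r * f j"
      then show "i = j" using digit[of i j "f i" "f j"] ij by simp
    qed
    have "card ?P \<le> card {e\<in>nsets {..<N} r. inj_on (\<lambda>x. x mod r) e}"
    proof (rule card_inj_on_le[where f = \<phi>])
      show "inj_on \<phi> ?P"
      proof (rule inj_onI)
        fix f g assume fg: "f \<in> ?P" "g \<in> ?P" "\<phi> f = \<phi> g"
        show "f = g"
        proof (rule PiE_ext[OF fg(1,2)])
          fix i assume i: "i \<in> {..<r}"
          then have "i + r * f i \<in> \<phi> g" using fg(3) unfolding \<phi>_def by auto
          then obtain j where j: "j < r" "i + r * f i = j + r * g j" unfolding \<phi>_def by auto
          then have "i = j" using digit[OF _ j] i by simp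
          then show "f i = g i" using j(2) assms(1) by simp
        qed
      qed
      show "\<phi> ` ?P \<subseteq> {e\<in>nsets {..<N} r. inj_on (\<lambda>x. x mod r) e}"
      proof (intro image_subsetI)
        fix f assume f: "f \<in> ?P"
        have "i + r * f i < N" if "i < r" for i
        proof -
          have "f i < N div r" using f that by auto
          then have "r * Suc (f i) \<le> r * (N div r)" by (intro mult_le_mono2 Suc_leI)
          also have "\<dots> \<le> N" by simp
          finally show ?thesis using that by simp
        qed
        then have "\<phi> f \<subseteq> {..<N}" unfolding \<phi>_def by auto
        moreover have "card (\<phi> f) = r" unfolding \<phi>_def using card_image[OF inj1] by simp
        moreover have "inj_on (\<lambda>x. x mod r) (\<phi> f)" unfolding \<phi>_def by (auto simp: inj_on_def)
        ultimately show "\<phi> f \<in> {e\<in>nsets {..<N} r. inj_on (\<lambda>x. x mod r) e}"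
          unfolding \<phi>_def by (auto simp: nsets_def)
      qed
    qed (simp add: finite_imp_finite_nsets)
    then show ?thesis by (simp add: card_PiE)
  qed
  ultimately show ?thesis by simp
qed

section \<open>The extremal family\<close>

text \<open>The extremal example: the star of \<open>x\<close> on \<open>insert x W\<close>, disjoint \<open>k\<close>-sets
  \<open>B\<^sub>i = {b i j | j < k}\<close>, and for every \<open>i\<close> the sets \<open>{x, b i j} \<union> e\<close> for an extremal multigraph
  on \<open>W\<close>, the index \<open>j\<close> numbering the parallel copies of an edge \<open>e\<close>. A cluster contains some
  \<open>B\<^sub>i\<close>; its members disjoint from \<open>B\<^sub>i\<close> fill the union, so there is at most one of them, and the
  remaining \<open>d - 2\<close> members give edges on \<open>k - 1\<close> vertices of \<open>W\<close>.\<close>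

lemma cluster_free_family_exists:
  fixes V W :: "'a set" and b :: "nat \<Rightarrow> nat \<Rightarrow> 'a"
  assumes d5: "5 \<le> d" and dk: "d \<le> k"
    and V: "finite V" "W \<subseteq> V" "x \<in> V" "x \<notin> W" "k - 1 \<le> card W"
    and b: "inj_on (\<lambda>(i, j). b i j) ({..<\<nu>} \<times> {..<k})"
      "\<And>i j. i < \<nu> \<Longrightarrow> j < k \<Longrightarrow> b i j \<in> V - W - {x}"
  shows "\<exists>F. F \<subseteq> nsets V k \<and> cluster_free k d F \<and> \<nu> + 1 \<le> matching_number F \<and>
    card F = (card W choose (k - 1)) + \<nu> * EX_multi (k - 2) (card W) (k - 1) (d - 2) + \<nu>"
proof -
  define r where "r = k - 2"
  have r: "r \<le> k - 1" "k = r + 2" "k - 1 = r + 1" using d5 dk unfolding r_def by auto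
  have finW: "finite W" using V finite_subset by blast
  have "1 \<le> d - 2" using d5 by simp
  then obtain w where w: "sparse r (k - 1) (d - 2) W w"
    "(\<Sum>e\<in>nsets W r. w e) = EX_multi r (card W) (k - 1) (d - 2)"
    using EX_multi_attained[OF r(1) V(5) _ finW] by metis
  \<comment> \<open>The points of \<open>B i\<close> are numerous enough to number the parallel
    copies of an edge.\<close>
  have wk: "w e < k" if "e \<in> nsets W r" for e
    using sparse_weight_less[OF w(1) finW r(1) V(5) that] dk by simp
  define B where "B i = b i ` {..<k}" for i
  define U where "U = (\<Union>i<\<nu>. B i)"
  have b_eq: "i = i' \<and> j = j'" if "b i j = b i' j'" "i < \<nu>" "i' < \<nu>" "j < k" "j' < k" for i i' j j'
    using inj_onD[OF b(1), of "(i, j)" "(i', j')"] that by auto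
  have U: "U \<subseteq> V" "U \<inter> W = {}" "x \<notin> U" using b(2) unfolding U_def B_def by auto
  have cB: "finite (B i)" "card (B i) = k" if "i < \<nu>" for i
  proof -
    have "inj_on (b i) {..<k}" using b_eq that by (intro inj_onI) auto
    then show "finite (B i)" "card (B i) = k" unfolding B_def by (auto simp: card_image)
  qed
  have dB: "B i \<inter> B i' = {}" if "i < \<nu>" "i' < \<nu>" "i \<noteq> i'" for i i'
    using b_eq that unfolding B_def by auto
  have B_U: "B i \<subseteq> U" if "i < \<nu>" for i using that unfolding U_def by auto
  have bU: "b i j \<in> B i" "b i j \<in> U" if "i < \<nu>" "j < k" for i j using that unfolding U_def B_def by auto
  define t where "t = (\<lambda>(i, e, j). insert x (insert (b i j) e))"
  define P where "P = (SIGMA i:{..<\<nu>}. SIGMA e:nsets W r. {..<w e})"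
  have P: "i < \<nu>" "e \<in> nsets W r" "j < k" "j < w e" if "(i, e, j) \<in> P" for i e j
    using that wk[of e] unfolding P_def by auto
  have tU: "t (i, e, j) \<inter> U = {b i j}" and tW: "t (i, e, j) \<inter> W = e" if "(i, e, j) \<in> P" for i e j
    using P[OF that] U V(4) bU[of i j] unfolding t_def by (auto simp: nsets_def)
  have injt: "inj_on t P"
  proof (rule inj_onI)
    fix p p' assume p: "p \<in> P" "p' \<in> P" "t p = t p'"
    obtain i e j i' e' j' where pe: "p = (i, e, j)" "p' = (i', e', j')" by (cases p, cases p')
    have "b i j = b i' j'" "e = e'" using tU tW p unfolding pe by (metis singleton_inject)+
    then show "p = p'" using b_eq P p(1,2) unfolding pe by blast
  qed
  define S0 where "S0 = insert x ` nsets W (k - 1)"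
  define S1 where "S1 = B ` {..<\<nu>}"
  define S2 where "S2 = t ` P"
  define F where "F = S0 \<union> S1 \<union> S2"
  have finP: "finite P" unfolding P_def by (intro finite_SigmaI finite_imp_finite_nsets finW) auto
  have fin: "finite S0" "finite S1" "finite S2"
    unfolding S0_def S1_def S2_def using finP by (auto intro: finite_imp_finite_nsets finW)
  have c0: "card S0 = card W choose (k - 1)"
  proof -
    have "inj_on (insert x) (nsets W (k - 1))"
      using V(4) by (intro inj_on_inverseI[where g = "\<lambda>A. A - {x}"]) (auto simp: nsets_def)
    then show ?thesis unfolding S0_def by (simp add: card_image)
  qed
  have c1: "card S1 = \<nu>"
  proof -
    have "B i \<noteq> {}" if "i < \<nu>" for i using cB[OF that] d5 dk by auto
    then have "inj_on B {..<\<nu>}" using dB by (intro inj_onI) (metis Int_absorb lessThan_iff)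
    then show ?thesis unfolding S1_def by (simp add: card_image)
  qed
  have c2: "card S2 = \<nu> * EX_multi r (card W) (k - 1) (d - 2)"
  proof -
    have "card S2 = card P" unfolding S2_def by (rule card_image[OF injt])
    also have "\<dots> = \<nu> * card (SIGMA e:nsets W r. {..<w e})"
      unfolding P_def by (simp add: card_cartesian_product)
    also have "card (SIGMA e:nsets W r. {..<w e}) = (\<Sum>e\<in>nsets W r. w e)"
      using finW by (subst card_SigmaI) (auto intro: finite_imp_finite_nsets)
    finally show ?thesis using w(2) by simp
  qed
  have x0: "x \<in> A \<and> A \<inter> U = {}" if "A \<in> S0" for A using that U unfolding S0_def by (auto simp: nsets_def)
  have x1: "x \<notin> A" if "A \<in> S1" for A using that U B_U unfolding S1_def by auto
  have x2: "x \<in> A \<and> A \<inter> U \<noteq> {}" if "A \<in> S2" for A using that tU unfolding S2_def by (force simp: t_def)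
  have "S0 \<inter> S1 = {}" "(S0 \<union> S1) \<inter> S2 = {}" using x0 x1 x2 by blast+
  then have cF: "card F = (card W choose (k - 1)) + \<nu> * EX_multi r (card W) (k - 1) (d - 2) + \<nu>"
    unfolding F_def using fin c0 c1 c2 by (simp add: card_Un_disjoint)
  have FV: "F \<subseteq> nsets V k"
  proof -
    have "S0 \<subseteq> nsets V k"
      unfolding S0_def
    proof (intro image_subsetI)
      fix S assume "S \<in> nsets W (k - 1)"
      then have S: "S \<subseteq> W" "finite S" "card S = k - 1" by (auto simp: nsets_def)
      then have "x \<notin> S" using V(4) by blast
      then have "card (insert x S) = k" using S r by simp
      then show "insert x S \<in> nsets V k" using S V by (auto simp: nsets_def)
    qed
    moreover have "S1 \<subseteq> nsets V k" using cB subset_trans[OF B_U U(1)] unfolding S1_def by (auto simp: nsets_def)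
    moreover have "S2 \<subseteq> nsets V k"
    proof
      fix A assume "A \<in> S2"
      then obtain i e j where p: "(i, e, j) \<in> P" "A = t (i, e, j)" unfolding S2_def by auto
      have e: "e \<subseteq> W" "finite e" "card e = r" using P(2)[OF p(1)] by (auto simp: nsets_def)
      have bb: "b i j \<in> V" "b i j \<notin> W" "b i j \<noteq> x" using b(2) P[OF p(1)] by auto
      have "b i j \<notin> e" "x \<notin> insert (b i j) e" using bb e V(4) by auto
      then have "card A = k" using e r(2) unfolding p(2) t_def by simp
      moreover have "A \<subseteq> V" "finite A" using e bb V unfolding p(2) t_def by auto
      ultimately show "A \<in> nsets V k" by (simp add: nsets_def)
    qed
    ultimately show ?thesis unfolding F_def by simp
  qed
  have "cluster_free k d F"
    unfolding cluster_free_def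
  proof
    assume "\<exists>C. C \<subseteq> F \<and> d_cluster k d C"
    then obtain C where C: "C \<subseteq> F" "finite C" "card C = d" "card (\<Union>C) \<le> 2 * k" "\<Inter>C = {}"
      and C': "\<And>A. A \<in> C \<Longrightarrow> finite A \<and> card A = k" unfolding d_cluster_def by blast
    have finU: "finite (\<Union>C)" using C(2) C' by auto
    obtain A where A: "A \<in> C" "x \<notin> A" using C(5) by blast
    then have "A \<in> S1" using C(1) x0 x2 unfolding F_def by blast
    then obtain i where i: "i < \<nu>" "A = B i" unfolding S1_def by auto
    define Y where "Y = \<Union>C - B i"
    have finY: "finite Y" unfolding Y_def using finU by simp
    have "card Y = card (\<Union>C) - card (B i)"
      unfolding Y_def using A(1) i cB[OF i(1)] by (intro card_Diff_subset) auto
    then have cY: "card Y \<le> k" using C(4) cB(2)[OF i(1)] by simp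
    define T where "T = {A\<in>C. A \<noteq> B i \<and> A \<inter> B i \<noteq> {}}"
    have T_edge: "\<exists>e j. (i, e, j) \<in> P \<and> A = t (i, e, j)" if A: "A \<in> T" for A
    proof -
      have "A \<in> F" "A \<noteq> B i" "A \<inter> B i \<noteq> {}" using A C(1) unfolding T_def by auto
      then have "A \<in> S2" using x0 B_U[OF i(1)] dB i(1) unfolding F_def S1_def by blast
      then obtain i' e j where p: "(i', e, j) \<in> P" "A = t (i', e, j)" unfolding S2_def by auto
      have "A \<inter> U = {b i' j}" using tU[OF p(1)] p(2) by simp
      then have "A \<inter> B i \<subseteq> {b i' j}" using B_U[OF i(1)] by blast
      then have "b i' j \<in> B i" using \<open>A \<inter> B i \<noteq> {}\<close> by blast
      then have "i' = i" using dB[of i i'] bU(1)[of i' j] P[OF p(1)] i(1) by blast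
      then show ?thesis using p by blast
    qed
    have "C \<subseteq> insert (B i) (insert Y T)"
    proof
      fix A assume A: "A \<in> C"
      show "A \<in> insert (B i) (insert Y T)"
      proof (cases "A \<inter> B i = {}")
        case True
        then have "A \<subseteq> Y" using A unfolding Y_def by auto
        then have "A = Y" using card_seteq[OF finY] cY C'[OF A] by simp
        then show ?thesis by simp
      qed (use A in \<open>auto simp: T_def\<close>)
    qed
    moreover have finT: "finite T" unfolding T_def using C(2) by simp
    ultimately have "card C \<le> card (insert (B i) (insert Y T))" by (intro card_mono) auto
    also have "\<dots> \<le> Suc (Suc (card T))"
      using finT by (simp add: card_insert_if)
    finally have cT: "d - 2 \<le> card T" using C(3) by simp
    then have "T \<noteq> {}" using d5 by auto
    then obtain A1 where A1: "A1 \<in> T" by blast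
    have "x \<in> A1" using T_edge[OF A1] unfolding t_def by auto
    then have "x \<in> Y" using A1 U(3) B_U[OF i(1)] unfolding Y_def T_def by auto
    then have "card (Y - {x}) \<le> k - 1" using cY finY by simp
    moreover have "card (Y \<inter> W) \<le> card (Y - {x})" using V(4) finY by (intro card_mono) auto
    ultimately have "card (Y \<inter> W) \<le> k - 1" by simp
    \<comment> \<open>As \<open>x\<close> occupies one of the at most \<open>k\<close> places of
      \<open>Y\<close>, at most \<open>k - 1\<close> are left for \<open>W\<close>. Since
      \<open>sparse\<close> speaks of exactly \<open>k - 1\<close> vertices, the set is
      padded.\<close>
    then obtain Z where Z: "Y \<inter> W \<subseteq> Z" "Z \<subseteq> W" "card Z = k - 1"
      using exists_subset_between[of "Y \<inter> W" "k - 1" W] V(5) finW by auto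
    have finZ: "finite Z" using Z(2) finW finite_subset by blast
    have "T \<subseteq> (\<lambda>(e, j). t (i, e, j)) ` (SIGMA e:nsets Z r. {..<w e})"
    proof
      fix A assume A: "A \<in> T"
      then obtain e j where p: "(i, e, j) \<in> P" "A = t (i, e, j)" using T_edge by blast
      have e: "e \<subseteq> W" "finite e" "card e = r" using P(2)[OF p(1)] by (auto simp: nsets_def)
      have "e \<subseteq> A" unfolding p(2) t_def by auto
      moreover have "e \<inter> B i = {}" using e(1) U(2) B_U[OF i(1)] by blast
      ultimately have "e \<subseteq> Y" using A unfolding T_def Y_def by blast
      then have "e \<in> nsets Z r" using e Z(1) by (auto simp: nsets_def)
      then have "(e, j) \<in> (SIGMA e:nsets Z r. {..<w e})" using P(4)[OF p(1)] by simp
      then show "A \<in> (\<lambda>(e, j). t (i, e, j)) ` (SIGMA e:nsets Z r. {..<w e})"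
        unfolding p(2) by (intro image_eqI[where x = "(e, j)"]) simp_all
    qed
    then have "card T \<le> card (SIGMA e:nsets Z r. {..<w e})"
      using finZ by (intro surj_card_le[where f = "\<lambda>(e, j). t (i, e, j)"] finite_SigmaI finite_imp_finite_nsets) auto
    also have "\<dots> = (\<Sum>e\<in>nsets Z r. w e)"
      using finZ by (subst card_SigmaI) (auto intro: finite_imp_finite_nsets)
    also have "\<dots> < d - 2" using w(1) Z finZ unfolding sparse_def by (auto simp: nsets_def)
    finally show False using cT by simp
  qed
  moreover have "\<nu> + 1 \<le> matching_number F"
  proof -
    obtain S where S: "S \<subseteq> W" "card S = k - 1" "finite S" using obtain_subset_with_card_n[OF V(5)] by blast
    have S0: "insert x S \<in> S0" using S unfolding S0_def by (auto simp: nsets_def)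
    define M where "M = insert (insert x S) S1"
    have "insert x S \<notin> S1" using x1 by blast
    then have cM: "card M = \<nu> + 1" unfolding M_def using fin c1 by simp
    have "insert x S \<inter> A = {}" if "A \<in> S1" for A
    proof -
      have "A \<subseteq> U" using that B_U unfolding S1_def by auto
      then show ?thesis using x0[OF S0] by blast
    qed
    moreover have "A \<inter> A' = {}" if "A \<in> S1" "A' \<in> S1" "A \<noteq> A'" for A A'
      using that dB unfolding S1_def by blast
    ultimately have "disjoint M" unfolding M_def disjoint_def by blast
    moreover have "M \<subseteq> F" unfolding M_def F_def using S0 by auto
    ultimately have mem: "card M \<in> {card M | M. M \<subseteq> F \<and> disjoint M}" by blast
    have "finite {card M | M. M \<subseteq> F \<and> disjoint M}"
    proof (rule finite_subset)
      show "{card M | M. M \<subseteq> F \<and> disjoint M} \<subseteq> {..card F}"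
        using fin unfolding F_def by (auto intro: card_mono)
    qed simp
    from Max_ge[OF this mem] show ?thesis unfolding matching_number_def cM .
  qed
  ultimately show ?thesis using FV cF unfolding r_def by blast
qed

lemma max_cluster_free_finite:
  "finite {card F | F. F \<subseteq> nsets {1..n::nat} k \<and> cluster_free k d F \<and> matching_number F \<ge> \<nu> + 1}"
proof (rule finite_subset)
  have "finite (nsets {1..n} k)" by (simp add: finite_imp_finite_nsets)
  then show "{card F | F. F \<subseteq> nsets {1..n} k \<and> cluster_free k d F \<and> matching_number F \<ge> \<nu> + 1}
      \<subseteq> {..card (nsets {1..n} k)}" using card_mono by blast
qed simp

lemma extremal_family:
  assumes d5: "5 \<le> d" and dk: "d \<le> k" and n: "k * (\<nu> + 1) \<le> n"
  obtains F where "F \<subseteq> nsets {1..n} k" "cluster_free k d F" "matching_number F \<ge> \<nu> + 1"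
    "card F = ((n - k * \<nu> - 1) choose (k - 1))
       + \<nu> * EX_multi (k - 2) (n - k * \<nu> - 1) (k - 1) (d - 2) + \<nu>"
proof -
  \<comment> \<open>The layout of \<open>{1..n}\<close>: consecutive blocks of length
    \<open>k\<close> fill the first \<open>k * \<nu>\<close> numbers, the centre comes next, and the
    rest is \<open>W\<close>.\<close>
  define b where "b i j = i * k + j + 1" for i j
  have nk: "k * \<nu> + k \<le> n" using n by simp
  have cW: "card {k * \<nu> + 2..n} = n - k * \<nu> - 1" by simp
  have bU: "1 \<le> b i j \<and> b i j \<le> k * \<nu>" if "i < \<nu>" "j < k" for i j
  proof -
    have "b i j \<le> i * k + k" using that unfolding b_def by simp
    also have "\<dots> \<le> \<nu> * k" using mult_le_mono1[of "Suc i" \<nu> k] that by simp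
    finally show ?thesis unfolding b_def by (simp add: mult.commute)
  qed
  have "\<exists>F. F \<subseteq> nsets {1..n} k \<and> cluster_free k d F \<and> \<nu> + 1 \<le> matching_number F \<and>
    card F = (card {k * \<nu> + 2..n} choose (k - 1))
      + \<nu> * EX_multi (k - 2) (card {k * \<nu> + 2..n}) (k - 1) (d - 2) + \<nu>"
  proof (rule cluster_free_family_exists[OF d5 dk, where x = "k * \<nu> + 1" and b = b])
    show "inj_on (\<lambda>(i, j). b i j) ({..<\<nu>} \<times> {..<k})"
    proof (rule inj_onI)
      fix p p' assume p: "p \<in> {..<\<nu>} \<times> {..<k}" "p' \<in> {..<\<nu>} \<times> {..<k}"
        "(\<lambda>(i, j). b i j) p = (\<lambda>(i, j). b i j) p'"
      obtain i j i' j' where ij: "p = (i, j)" "p' = (i', j')" by (cases p, cases p')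
      have eq: "i * k + j = i' * k + j'" "j < k" "j' < k" using p unfolding ij b_def by auto
      then have "j = j'" by (metis mod_less mod_mult_self3)
      then show "p = p'" using eq unfolding ij by simp
    qed
    show "b i j \<in> {1..n} - {k * \<nu> + 2..n} - {k * \<nu> + 1}" if "i < \<nu>" "j < k" for i j
      using bU[OF that] nk by auto
    show "k - 1 \<le> card {k * \<nu> + 2..n}" using nk unfolding cW by simp
  qed (use nk d5 dk in auto)
  then show ?thesis using that unfolding cW by blast
qed

section \<open>The upper bound\<close>

lemma choose_diff_le: "n choose j \<le> ((n - s) choose j) + s * n ^ (j - 1)"
proof (induction s)
  case (Suc s)
  have "(n - s) choose j \<le> ((n - Suc s) choose j) + n ^ (j - 1)"
  proof (cases "n - s = 0 \<or> j = 0")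
    case False
    then obtain m i where m: "n - s = Suc m" and i: "j = Suc i" by (metis not0_implies_Suc)
    then have "n - Suc s = m" by simp
    moreover have "m choose i \<le> n ^ i"
      using m by (intro order.trans[OF choose_le_power] power_mono) auto
    ultimately show ?thesis using m i by simp
  qed auto
  with Suc show ?case by simp
qed simp

context cluster_free_family
begin

lemma weight_le_k: "B \<in> F \<Longrightarrow> weight x B e \<le> k"
  using F_D[of B] card_mono[of B "{b\<in>B. insert x (insert b e) \<in> F}"] unfolding weight_def by auto

lemma violating_subset_missing:
  assumes "B \<in> F" "x \<notin> B" "W \<subseteq> V - insert x B"
  shows "{Y\<in>nsets W (k - 1). d - 2 \<le> (\<Sum>e\<in>nsets Y (k - 2). weight x B e)} \<subseteq> missing x"
proof
  fix Y assume Y: "Y \<in> {Y\<in>nsets W (k - 1). d - 2 \<le> (\<Sum>e\<in>nsets Y (k - 2). weight x B e)}"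
  then have "Y \<in> nsets (V - insert x B) (k - 1)" using nsets_mono[OF assms(3)] by auto
  then show "Y \<in> missing x"
    using weight_sum_less[OF assms(1,2), of Y] Y unfolding missing_def by (fastforce simp: nsets_def)
qed

text \<open>At most one set of a matching contains \<open>x\<close>; this is where the extra 1 in
  the matching number is spent.\<close>

lemma matching_avoiding:
  assumes "matching_number F \<ge> \<nu> + 1"
  obtains \<B> where "\<B> \<subseteq> F" "disjoint \<B>" "card \<B> = \<nu>" "\<And>B. B \<in> \<B> \<Longrightarrow> x \<notin> B"
proof -
  let ?S = "{card M | M. M \<subseteq> F \<and> disjoint M}"
  have "?S \<subseteq> {..card F}" using finF by (auto intro: card_mono)
  then have "finite ?S" using finite_subset by blast
  moreover have "?S \<noteq> {}" by (auto intro: exI[of _ "{}"] simp: disjoint_def)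
  ultimately have "Max ?S \<in> ?S" by (rule Max_in)
  then obtain M where M: "M \<subseteq> F" "disjoint M" "\<nu> + 1 \<le> card M"
    using assms unfolding matching_number_def by auto
  define M0 where "M0 = {A\<in>M. x \<in> A}"
  have fM: "finite M" using M(1) finF finite_subset by blast
  have "card M0 \<le> 1"
    using M(2) fM unfolding M0_def by (subst card_le_Suc0_iff_eq[folded One_nat_def]) (auto simp: disjoint_def)
  moreover have "M0 \<subseteq> M" unfolding M0_def by auto
  ultimately have "\<nu> \<le> card (M - M0)" using M(3) fM by (simp add: card_Diff_subset finite_subset)
  then obtain \<B> where \<B>: "\<B> \<subseteq> M - M0" "card \<B> = \<nu>" by (metis obtain_subset_with_card_n)
  show ?thesis
  proof (rule that[of \<B>])
    show "disjoint \<B>" using \<B>(1) by (intro pairwise_subset[OF M(2)]) auto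
  qed (use \<B> M(1) in \<open>auto simp: M0_def\<close>)
qed

text \<open>The members through \<open>x\<close> are sorted by how often they meet
  \<open>\<Union>\<B>\<close> : never, which gives the full binomial less the missing sets; once,
  which the weights of the blocks count; or at least twice, which is of lower order. The missing
  sets are kept on the left to be cancelled by \<open>card_avoiding_le\<close>.\<close>

lemma card_decomposition:
  assumes x: "x \<in> V" and \<B>: "\<B> \<subseteq> F" "disjoint \<B>" "card \<B> = \<nu>" "\<And>B. B \<in> \<B> \<Longrightarrow> x \<notin> B"
  shows "card (\<Union>\<B>) = k * \<nu>" "card (V - {x} - \<Union>\<B>) = card V - k * \<nu> - 1"
    and "card F + card {S\<in>missing x. S \<inter> \<Union>\<B> = {}} \<le> card {A\<in>F. x \<notin> A}
      + ((card V - k * \<nu> - 1) choose (k - 1))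
      + (\<Sum>B\<in>\<B>. \<Sum>e\<in>nsets (V - {x} - \<Union>\<B>) (k - 2). weight x B e)
      + (k * \<nu>)\<^sup>2 * card V ^ (k - 3)"
proof -
  define U where "U = \<Union>\<B>"
  define W where "W = V - {x} - U"
  have f\<B>: "finite \<B>" using \<B>(1) finF finite_subset by blast
  have fB: "B \<subseteq> V \<and> finite B \<and> card B = k" if "B \<in> \<B>" for B using F_D that \<B>(1) by blast
  have U: "finite U" "U \<subseteq> V" "x \<notin> U" using f\<B> fB \<B>(4) unfolding U_def by auto
  have "card U = (\<Sum>B\<in>\<B>. card B)"
    unfolding U_def using \<B>(2) fB by (intro card_Union_disjoint) (auto simp: disjoint_def pairwise_def disjnt_def)
  then have cU: "card U = k * \<nu>" using fB \<B>(3) by (simp add: mult.commute)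
  then show "card (\<Union>\<B>) = k * \<nu>" unfolding U_def .
  have "card W = card V - 1 - card U"
    unfolding W_def using U finV x by (subst card_Diff_subset) (auto simp: card_Diff_singleton)
  then have cW: "card W = card V - k * \<nu> - 1" using cU by simp
  then show "card (V - {x} - \<Union>\<B>) = card V - k * \<nu> - 1" unfolding W_def U_def .
  have finW: "finite W" unfolding W_def using finV by simp
  have finn: "finite (nsets X j)" if "X \<subseteq> V" for X j
    using that finV finite_subset finite_imp_finite_nsets by metis
  define S where "S = {S\<in>nsets (V - {x}) (k - 1). insert x S \<in> F}"
  define S0 where "S0 = {T\<in>S. T \<inter> U = {}}"
  define S1 where "S1 = {T\<in>S. card (T \<inter> U) = 1}"
  define S2 where "S2 = {T\<in>S. 2 \<le> card (T \<inter> U)}"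
  have finS: "finite S" unfolding S_def using finn by simp
  have cF: "card F \<le> card {A\<in>F. x \<notin> A} + card S"
  proof -
    have "card {A\<in>F. x \<in> A} \<le> card S"
    proof (rule card_inj_on_le[where f = "\<lambda>A. A - {x}"])
      show "inj_on (\<lambda>A. A - {x}) {A\<in>F. x \<in> A}" by (auto simp: inj_on_def)
      show "(\<lambda>A. A - {x}) ` {A\<in>F. x \<in> A} \<subseteq> S"
        using F_D unfolding S_def by (auto simp: nsets_def insert_absorb)
    qed (rule finS)
    moreover have "card F \<le> card {A\<in>F. x \<notin> A} + card {A\<in>F. x \<in> A}"
      using card_Un_le[of "{A\<in>F. x \<notin> A}" "{A\<in>F. x \<in> A}"] by (simp add: Collect_disj_eq[symmetric] conj_disj_distribL[symmetric])
    ultimately show ?thesis by simp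
  qed
  have "S \<subseteq> S0 \<union> (S1 \<union> S2)"
  proof
    fix T assume T: "T \<in> S"
    then have "finite (T \<inter> U)" using U by simp
    then have "T \<inter> U = {} \<or> card (T \<inter> U) = 1 \<or> 2 \<le> card (T \<inter> U)"
      by (metis One_nat_def card_eq_0_iff less_2_cases_iff linorder_not_le)
    then show "T \<in> S0 \<union> (S1 \<union> S2)" using T unfolding S0_def S1_def S2_def by auto
  qed
  then have "card S \<le> card (S0 \<union> (S1 \<union> S2))"
    using finS by (intro card_mono) (auto simp: S0_def S1_def S2_def)
  also have "\<dots> \<le> card S0 + (card S1 + card S2)"
    by (intro order.trans[OF card_Un_le] add_left_mono card_Un_le)
  finally have cS: "card S \<le> card S0 + (card S1 + card S2)" .
  have S0: "card S0 + card {T\<in>missing x. T \<inter> U = {}} = (card V - k * \<nu> - 1) choose (k - 1)"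
  proof -
    have "nsets W (k - 1) = S0 \<union> {T\<in>missing x. T \<inter> U = {}}" "S0 \<inter> {T\<in>missing x. T \<inter> U = {}} = {}"
      unfolding W_def S0_def S_def missing_def by (auto simp: nsets_def)
    moreover have "finite (nsets W (k - 1))" by (rule finn) (auto simp: W_def)
    ultimately show ?thesis using cW by (metis card_Un_disjoint card_nsets finite_Un)
  qed
  have S1: "card S1 \<le> (\<Sum>B\<in>\<B>. \<Sum>e\<in>nsets W (k - 2). weight x B e)"
  proof -
    define P where "P = (SIGMA B:\<B>. SIGMA e:nsets W (k - 2). {b\<in>B. insert x (insert b e) \<in> F})"
    have finP: "finite P"
      unfolding P_def using f\<B> fB finW by (intro finite_SigmaI finite_imp_finite_nsets) auto
    have "S1 \<subseteq> (\<lambda>(B, e, b). insert b e) ` P"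
    proof
      fix T assume T: "T \<in> S1"
      then have "card (T \<inter> U) = 1" unfolding S1_def by simp
      then obtain b where b: "T \<inter> U = {b}" by (rule card_1_singletonE)
      then obtain B where B: "B \<in> \<B>" "b \<in> B" unfolding U_def by auto
      have fT: "finite T" "card T = k - 1" "T \<subseteq> V - {x}" "insert x T \<in> F"
        using T unfolding S1_def S_def by (auto simp: nsets_def)
      have bT: "insert b (T - {b}) = T" "b \<in> T" using b by auto
      have "T - {b} \<subseteq> W" using fT(3) b unfolding W_def by blast
      moreover have "card (T - {b}) = k - 2" using fT(1,2) bT(2) by simp
      ultimately have "T - {b} \<in> nsets W (k - 2)" using fT(1) by (simp add: nsets_def)
      then have "(B, T - {b}, b) \<in> P" unfolding P_def using B bT fT by simp
      then show "T \<in> (\<lambda>(B, e, b). insert b e) ` P" 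
        using bT by (intro image_eqI[where x = "(B, T - {b}, b)"]) (simp_all add: insert_absorb)
    qed
    then have "card S1 \<le> card P" using finP by (meson surj_card_le)
    also have "\<dots> = (\<Sum>B\<in>\<B>. \<Sum>e\<in>nsets W (k - 2). weight x B e)"
      unfolding P_def weight_def using f\<B> fB finW
      by (subst card_SigmaI) (auto intro!: finite_SigmaI sum.cong card_SigmaI finite_imp_finite_nsets)
    finally show ?thesis .
  qed
  have "card S2 \<le> card (nsets U 2) * card V ^ (k - 1 - 2)"
  proof (rule card_containing_le[OF finV])
    show "finite (nsets U 2)" "nsets U 2 \<subseteq> nsets V 2" using U by (auto simp: finite_imp_finite_nsets nsets_def)
    show "S2 \<subseteq> {A \<in> nsets V (k - 1). \<exists>L\<in>nsets U 2. L \<subseteq> A}"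
    proof
      fix T assume T: "T \<in> S2"
      then obtain L where "L \<subseteq> T \<inter> U" "card L = 2" "finite L"
        unfolding S2_def using obtain_subset_with_card_n by blast
      then show "T \<in> {A \<in> nsets V (k - 1). \<exists>L\<in>nsets U 2. L \<subseteq> A}"
        using T unfolding S2_def S_def by (auto simp: nsets_def)
    qed
  qed
  also have "\<dots> \<le> (k * \<nu>)\<^sup>2 * card V ^ (k - 3)"
  proof -
    have "k - 1 - 2 = k - 3" by simp
    then show ?thesis using card_nsets_le[OF U(1), of 2] unfolding cU by (simp only: mult_right_mono zero_le)
  qed
  finally have S2: "card S2 \<le> (k * \<nu>)\<^sup>2 * card V ^ (k - 3)" .
  show "card F + card {S\<in>missing x. S \<inter> \<Union>\<B> = {}} \<le> card {A\<in>F. x \<notin> A}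
      + ((card V - k * \<nu> - 1) choose (k - 1))
      + (\<Sum>B\<in>\<B>. \<Sum>e\<in>nsets (V - {x} - \<Union>\<B>) (k - 2). weight x B e)
      + (k * \<nu>)\<^sup>2 * card V ^ (k - 3)"
    using cF cS S0 S1 S2 unfolding W_def U_def by linarith
qed

end

text \<open>If \<open>F\<close> is no larger than the main binomial, nothing is left to prove, so
  \<open>F\<close> may be taken large enough for \<open>star_structure\<close>. Adding
  \<open>card_decomposition\<close> and \<open>card_avoiding_le\<close> cancels the missing sets.
  Each of the \<open>\<nu>\<close> blocks then contributes at most EX plus a small multiple of
  \<open>m ^ r\<close>, and \<open>EX_multi_ge_partite\<close> absorbs all errors.\<close>

lemma cluster_free_card_le:
  fixes k d \<nu> :: nat and \<delta> :: real
  assumes d5: "5 \<le> d" and dk: "d \<le> k" and \<delta>: "0 < \<delta>"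
  shows "\<exists>n0. \<forall>n\<ge>n0. \<forall>V :: 'a set. \<forall>F. finite V \<longrightarrow> card V = n \<longrightarrow> F \<subseteq> nsets V k \<longrightarrow> cluster_free k d F \<longrightarrow>
     \<nu> + 1 \<le> matching_number F \<longrightarrow>
     real (card F) \<le> real ((n - k * \<nu> - 1) choose (k - 1))
       + (real \<nu> + \<delta>) * real (EX_multi (k - 2) (n - k * \<nu> - 1) (k - 1) (d - 2))"
proof -
  define r where "r = k - 2"
  have r: "k - 1 = r + 1" "k - 3 = r - 1" "3 \<le> r" "r < k - 1" using d5 dk unfolding r_def by auto
  \<comment> \<open>The number of vertices outside \<open>W\<close>. Passing from \<open>n\<close>
    to \<open>n - L\<close> lowers the binomial by at most \<open>L * n ^ (k - 2)\<close>, the slack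
    allowed in \<open>large\<close>.\<close>
  define L where "L = k * \<nu> + 1"
  define c where "c = L + 4 * k ^ 3 + star_const k L"
  \<comment> \<open>\<open>(2 * r) ^ r\<close> comes from \<open>choose_ge_power\<close>; the factor
    2 leaves a second \<open>n ^ r\<close> to absorb the edges of full weight.\<close>
  define q where "q = 2 * (2 * r) ^ r"
  define c2 where "c2 = (k * \<nu>)\<^sup>2 + (q * k * k * c + k * \<nu>) ^ 3"
  \<comment> \<open>As \<open>m ^ r\<close> is at most \<open>(2 * r) ^ r\<close> times EX, the
    losses of all blocks together stay below half of \<open>\<delta>\<close> times EX;
    \<open>\<nu> + 1\<close> keeps the denominator positive when \<open>\<nu> = 0\<close>.\<close>
  define \<delta>' where "\<delta>' = \<delta> / (2 * (real \<nu> + 1) * (2 * real r) ^ r)"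
  have \<delta>': "0 < \<delta>'" using \<delta> r unfolding \<delta>'_def by simp
  have "1 \<le> r" "1 \<le> d - 2" using r(3) d5 by auto
  \<comment> \<open>The factor \<open>2 ^ r\<close> turns the bound on missing sets from powers of
    \<open>n\<close> into powers of \<open>m\<close>, using \<open>n \<le> 2 * m\<close>.\<close>
  from sum_le_EX_multi_approx[OF this(1) r(4) this(2) \<delta>', where 'a = 'a and K = k and C = "c * 2 ^ r"]
  obtain N0 where N0: "\<forall>N\<ge>N0. \<forall>W :: 'a set. \<forall>w. finite W \<longrightarrow> card W = N \<longrightarrow> (\<forall>e. w e \<le> k) \<longrightarrow>
     card {Y\<in>nsets W (k - 1). d - 2 \<le> (\<Sum>e\<in>nsets Y r. w e)} \<le> (c * 2 ^ r) * N ^ (k - 1 - 1) \<longrightarrow>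
     real (\<Sum>e\<in>nsets W r. w e) \<le> real (EX_multi r N (k - 1) (d - 2)) + \<delta>' * real N ^ r"
    by (rule exE)
  define n1 where "n1 = nat \<lceil>real (2 * c2 * 2 ^ r * (2 * r) ^ r) / \<delta>\<rceil>"
  define n0 where "n0 = 4 * k + 2 * L + N0 + n1 + (star_const k L * (2 * (k - 1)) ^ (k - 1) + 1)
     + (2 * (1 + k + k * \<nu>) + 2 * r) + q * (2 * k * c)"
  show ?thesis
  proof (intro exI[of _ n0] allI impI)
    fix n and V :: "'a set" and F
    assume n: "n0 \<le> n" and V: "finite V" "card V = n" and F: "F \<subseteq> nsets V k" "cluster_free k d F"
      and mat: "\<nu> + 1 \<le> matching_number F"
    interpret cluster_free_family V F k d using V F d5 dk by unfold_locales
    have big: "4 * k \<le> n" "2 * L \<le> n" "L + N0 \<le> n" "L + n1 \<le> n" "L + k \<le> n"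
      "star_const k L * (2 * (k - 1)) ^ (k - 1) + 1 \<le> n" "2 * (k - 1) \<le> n"
      "2 * (1 + k + k * \<nu>) + 2 * r \<le> n" "q * (2 * k * c) \<le> n"
      using n unfolding n0_def by simp_all
    define m where "m = n - k * \<nu> - 1"
    have m: "m = n - L" "n \<le> 2 * m" "N0 \<le> m" "n1 \<le> m" "k \<le> m" using big unfolding m_def L_def by auto
    define X where "X = real (EX_multi r m (k - 1) (d - 2))"
    have Xlow: "real m ^ r \<le> (2 * real r) ^ r * X"
    proof -
      have "m < r * (m div r) + r" using r mult_div_mod_eq[of r m] mod_less_divisor[of r m] by linarith
      moreover have "0 < m div r" using m(5) r(3) unfolding div_greater_zero_iff r_def by arith
      then have "r \<le> r * (m div r)" by simp
      ultimately have "m \<le> 2 * r * (m div r)" by linarith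
      then have "m ^ r \<le> (2 * r * (m div r)) ^ r" by (rule power_mono) simp
      also have "\<dots> = (2 * r) ^ r * (m div r) ^ r" by (rule power_mult_distrib)
      also have "(m div r) ^ r \<le> EX_multi r m (r + 1) (d - 2)"
        by (rule EX_multi_ge_partite) (use r d5 m in auto)
      finally have "m ^ r \<le> (2 * r) ^ r * EX_multi r m (k - 1) (d - 2)" using r by simp
      then have "real (m ^ r) \<le> real ((2 * r) ^ r * EX_multi r m (k - 1) (d - 2))" by (simp only: of_nat_le_iff)
      then show ?thesis unfolding X_def by simp
    qed
    have Xpos: "0 \<le> X" unfolding X_def by simp
    have "real (card F) \<le> real (m choose (k - 1)) + (real \<nu> + \<delta>) * X"
    proof (cases "card F \<le> m choose (k - 1)")
      case True
      then have "real (card F) \<le> real (m choose (k - 1))" by simp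
      moreover have "0 \<le> (real \<nu> + \<delta>) * X" using Xpos \<delta> by simp
      ultimately show ?thesis by linarith
    next
      case False
      have "n choose (k - 1) \<le> (m choose (k - 1)) + L * n ^ (k - 1 - 1)"
        unfolding m(1) by (rule choose_diff_le)
      then have large: "card V choose (k - 1) \<le> card F + L * card V ^ (k - 2)"
        using False V by (simp add: numeral_2_eq_2)
      have "star_const k L * card V ^ (k - 2) < card V choose (k - 1)"
      proof -
        define b where "b = (2 * (k - 1)) ^ (k - 1)"
        have bpos: "0 < b" unfolding b_def using d5 dk by simp
        have "b * (star_const k L * n ^ (k - 2)) = (star_const k L * b) * n ^ (k - 2)" by simp
        also have "\<dots> < n * n ^ (k - 2)" using big(6) unfolding b_def by (intro mult_strict_right_mono) auto
        also have "\<dots> = n ^ (k - 1)" using r unfolding r_def by simp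
        also have "\<dots> \<le> b * ((n - 0) choose (k - 1))" unfolding b_def by (rule choose_ge_power) (use big in simp)
        finally show ?thesis using V bpos by simp
      qed
      from star_structure[OF large this] obtain x where x: "x \<in> V"
        and D0: "card {A\<in>F. x \<notin> A} \<le> (L + 4 * k ^ 3 + star_const k L) * card V ^ (k - 2)"
        and M0: "card (missing x) \<le> star_const k L * card V ^ (k - 2)"
        unfolding missing_def by blast
      have D: "card {A\<in>F. x \<notin> A} \<le> c * card V ^ (k - 2)" using D0 unfolding c_def .
      have M: "card (missing x) \<le> c * card V ^ (k - 2)"
        by (rule order.trans[OF M0]) (simp add: c_def)
      obtain \<B> where \<B>: "\<B> \<subseteq> F" "disjoint \<B>" "card \<B> = \<nu>" "\<And>B. B \<in> \<B> \<Longrightarrow> x \<notin> B"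
        using matching_avoiding[OF mat] by blast
      note dec = card_decomposition[OF x \<B>]
      define W where "W = V - {x} - \<Union>\<B>"
      have f\<B>: "finite \<B>" using \<B>(1) finF finite_subset by blast
      have fU: "finite (\<Union>\<B>)" using f\<B> \<B>(1) F_D by auto
      have "card V ^ (k - 2) + q * (2 * k * c * card V ^ (k - 3)) \<le>
          q * ((card V - (1 + k + k * \<nu>)) choose (k - 2))"
      proof -
        have "n ^ r \<le> (2 * r) ^ r * ((n - (1 + k + k * \<nu>)) choose r)"
          by (rule choose_ge_power) (use big in simp)
        then have "2 * n ^ r \<le> q * ((n - (1 + k + k * \<nu>)) choose r)" unfolding q_def by simp
        moreover have "q * (2 * k * c * n ^ (r - 1)) \<le> n ^ r"
        proof -
          have "q * (2 * k * c) * n ^ (r - 1) \<le> n * n ^ (r - 1)" using big(9) by (rule mult_right_mono) simp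
          also have "\<dots> = n ^ r" using r by (cases r) auto
          finally show ?thesis by (simp add: mult.assoc)
        qed
        ultimately have "n ^ r + q * (2 * k * c * n ^ (r - 1)) \<le> q * ((n - (1 + k + k * \<nu>)) choose r)"
          by linarith
        then show ?thesis unfolding V(2) r(2) r_def[symmetric] .
      qed
      from card_avoiding_le[OF D M fU _ _ this] have av: "card {A\<in>F. x \<notin> A} \<le>
          card {S\<in>missing x. S \<inter> \<Union>\<B> = {}} + (q * k * k * c + k * \<nu>) ^ 3 * card V ^ (k - 3)"
        using dec(1) big(1) V by simp
      have "card F \<le> (m choose (k - 1)) + (\<Sum>B\<in>\<B>. \<Sum>e\<in>nsets W r. weight x B e) + c2 * n ^ (r - 1)"
        using dec(3) av unfolding W_def[symmetric] r(2) r_def[symmetric] V(2) m_def[symmetric] c2_def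
        by (simp add: distrib_right)
      then have "real (card F) \<le> real (m choose (k - 1)) + (\<Sum>B\<in>\<B>. real (\<Sum>e\<in>nsets W r. weight x B e)) + real (c2 * n ^ (r - 1))"
        by (metis of_nat_add of_nat_le_iff of_nat_sum)
      also have "(\<Sum>B\<in>\<B>. real (\<Sum>e\<in>nsets W r. weight x B e)) \<le> (\<Sum>B\<in>\<B>. X + \<delta>' * real m ^ r)"
      proof (rule sum_mono)
        fix B assume B: "B \<in> \<B>"
        then have BF: "B \<in> F" "x \<notin> B" "W \<subseteq> V - insert x B" using \<B> unfolding W_def by auto
        have fm: "finite (missing x)" unfolding missing_def using V by (simp add: finite_imp_finite_nsets)
        show "real (\<Sum>e\<in>nsets W r. weight x B e) \<le> X + \<delta>' * real m ^ r"
          unfolding X_def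
        proof (rule N0[rule_format, OF m(3)])
          show "finite W" unfolding W_def using V by simp
          show "card W = m" unfolding W_def m_def using dec(2) V by simp
          show "weight x B e \<le> k" for e by (rule weight_le_k[OF BF(1)])
          have "card {Y\<in>nsets W (k - 1). d - 2 \<le> (\<Sum>e\<in>nsets Y r. weight x B e)} \<le> card (missing x)"
            using violating_subset_missing[OF BF] fm unfolding r_def by (intro card_mono)
          also have "\<dots> \<le> c * n ^ r" using M V unfolding r_def by simp
          also have "\<dots> \<le> c * (2 * m) ^ r" using m(2) by (intro mult_left_mono power_mono) auto
          also have "\<dots> = c * 2 ^ r * m ^ (k - 1 - 1)" using r by (simp add: power_mult_distrib)
          finally show "card {Y\<in>nsets W (k - 1). d - 2 \<le> (\<Sum>e\<in>nsets Y r. weight x B e)} \<le> c * 2 ^ r * m ^ (k - 1 - 1)" .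
        qed
      qed
      also have "(\<Sum>B\<in>\<B>. X + \<delta>' * real m ^ r) = real \<nu> * X + real \<nu> * \<delta>' * real m ^ r"
        using \<B>(3) by (simp add: distrib_left)
      also have "real \<nu> * \<delta>' * real m ^ r \<le> \<delta> / 2 * X"
      proof -
        have "real \<nu> * \<delta>' * real m ^ r \<le> (real \<nu> + 1) * \<delta>' * ((2 * real r) ^ r * X)"
          using Xlow \<delta>' by (intro mult_mono) auto
        also have "\<dots> = \<delta> / 2 * X"
        proof -
          have "a * (\<delta> / (2 * a * p)) * (p * X) = \<delta> / 2 * X" if "0 < a" "0 < p" for a p :: real
            using that by simp
          from this[of "real \<nu> + 1" "(2 * real r) ^ r"] show ?thesis
            unfolding \<delta>'_def using r(3) by simp
        qed
        finally show ?thesis .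
      qed
      also have "real (c2 * n ^ (r - 1)) \<le> \<delta> / 2 * X"
      proof -
        have "real n ^ (r - 1) \<le> (2 * real m) ^ (r - 1)" using m(2) by (intro power_mono) auto
        also have "\<dots> = 2 ^ (r - 1) * real m ^ (r - 1)" by (rule power_mult_distrib)
        also have "\<dots> \<le> 2 ^ r * real m ^ (r - 1)" by (intro mult_right_mono power_increasing) auto
        finally have "real c2 * real n ^ (r - 1) \<le> real c2 * (2 ^ r * real m ^ (r - 1))"
          by (rule mult_left_mono) simp
        moreover have "real (2 * c2 * 2 ^ r * (2 * r) ^ r) / \<delta> \<le> real m" using m(4) unfolding n1_def by linarith
        then have "real (2 * c2 * 2 ^ r * (2 * r) ^ r) \<le> \<delta> * real m" using \<delta> by (simp add: field_simps)
        then have "real (2 * c2 * 2 ^ r * (2 * r) ^ r) * real m ^ (r - 1) \<le> \<delta> * real m * real m ^ (r - 1)"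
          by (rule mult_right_mono) simp
        moreover have "real m * real m ^ (r - 1) = real m ^ r" using r by (cases r) auto
        ultimately have "2 * (2 * real r) ^ r * (real c2 * real n ^ (r - 1)) \<le> \<delta> * real m ^ r"
          using mult_left_mono[of "real c2 * real n ^ (r - 1)" "real c2 * (2 ^ r * real m ^ (r - 1))" "2 * (2 * real r) ^ r"]
          by (simp add: mult_ac)
        also have "\<dots> \<le> \<delta> * ((2 * real r) ^ r * X)" using Xlow \<delta> by (intro mult_left_mono) auto
        finally have "(2 * real r) ^ r * (2 * (real c2 * real n ^ (r - 1))) \<le> (2 * real r) ^ r * (\<delta> * X)"
          by (simp add: mult_ac)
        moreover have "0 < (2 * real r) ^ r" using r by simp
        ultimately have "2 * (real c2 * real n ^ (r - 1)) \<le> \<delta> * X" by (rule mult_left_le_imp_le)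
        then show ?thesis by simp
      qed
      finally show ?thesis by (simp add: algebra_simps)
    qed
    then show "real (card F) \<le> real ((n - k * \<nu> - 1) choose (k - 1))
       + (real \<nu> + \<delta>) * real (EX_multi (k - 2) (n - k * \<nu> - 1) (k - 1) (d - 2))"
      unfolding m_def X_def r_def .
  qed
qed

theorem theorem1p8:
  fixes k d \<nu> :: nat
  assumes "5 \<le> d" and "d \<le> k"
  shows "(\<forall>n \<ge> k * (\<nu> + 1).
            max_cluster_free n k d \<nu> \<ge>
              ((n - k * \<nu> - 1) choose (k - 1))
              + \<nu> * EX_multi (k - 2) (n - k * \<nu> - 1) (k - 1) (d - 2) + \<nu>)
       \<and> (\<exists>\<epsilon> :: nat \<Rightarrow> real. \<epsilon> \<longlonglongrightarrow> 0 \<and>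
            (\<forall>\<^sub>F n in sequentially.
               real (max_cluster_free n k d \<nu>) \<le>
                 real ((n - k * \<nu> - 1) choose (k - 1))
                 + (real \<nu> + \<epsilon> n) * real (EX_multi (k - 2) (n - k * \<nu> - 1) (k - 1) (d - 2))))"
proof -
  define X where "X n = EX_multi (k - 2) (n - k * \<nu> - 1) (k - 1) (d - 2)" for n
  define c where "c n = (n - k * \<nu> - 1) choose (k - 1)" for n
  define f where "f n = max_cluster_free n k d \<nu>" for n
  define \<F> where "\<F> n = {F. F \<subseteq> nsets {1..n} k \<and> cluster_free k d F \<and> matching_number F \<ge> \<nu> + 1}" for n :: nat
  have f_eq: "f n = Max {card F | F. F \<in> \<F> n}" for n
    unfolding f_def \<F>_def max_cluster_free_def by simp
  have fin: "finite {card F | F. F \<in> \<F> n}" for n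
    using max_cluster_free_finite unfolding \<F>_def by simp
  have ex: "\<exists>F\<in>\<F> n. card F = c n + \<nu> * X n + \<nu>" if "k * (\<nu> + 1) \<le> n" for n
    using extremal_family[OF assms that] unfolding \<F>_def c_def X_def by blast
  have lower: "c n + \<nu> * X n + \<nu> \<le> f n" if n: "k * (\<nu> + 1) \<le> n" for n
    unfolding f_eq
  proof (rule Max_ge[OF fin])
    show "c n + \<nu> * X n + \<nu> \<in> {card F | F. F \<in> \<F> n}"
      using ex[OF n] unfolding mem_Collect_eq by metis
  qed
  have upper: "\<forall>\<^sub>F n in sequentially. real (f n) \<le> real (c n) + (real \<nu> + \<delta>) * real (X n)"
    if \<delta>: "0 < \<delta>" for \<delta> :: real
  proof -
    obtain n0 where n0: "\<forall>n\<ge>n0. \<forall>V :: nat set. \<forall>F. finite V \<longrightarrow> card V = n \<longrightarrow> F \<subseteq> nsets V k \<longrightarrow>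
       cluster_free k d F \<longrightarrow> \<nu> + 1 \<le> matching_number F \<longrightarrow>
       real (card F) \<le> real ((n - k * \<nu> - 1) choose (k - 1))
         + (real \<nu> + \<delta>) * real (EX_multi (k - 2) (n - k * \<nu> - 1) (k - 1) (d - 2))"
      using cluster_free_card_le[OF assms \<delta>, where 'a = nat and \<nu> = \<nu>] by (rule exE)
    show ?thesis
      unfolding eventually_sequentially
    proof (intro exI[of _ "max n0 (k * (\<nu> + 1))"] allI impI)
      fix n assume n: "max n0 (k * (\<nu> + 1)) \<le> n"
      then have "{card F | F. F \<in> \<F> n} \<noteq> {}" using ex[of n] by auto
      then have "f n \<in> {card F | F. F \<in> \<F> n}" unfolding f_eq by (rule Max_in[OF fin])
      then obtain F where F: "F \<in> \<F> n" "f n = card F" by blast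
      show "real (f n) \<le> real (c n) + (real \<nu> + \<delta>) * real (X n)"
        unfolding F(2) c_def X_def
        by (rule n0[rule_format, of n "{1..n}"]) (use n F(1) in \<open>auto simp: \<F>_def\<close>)
    qed
  qed
  \<comment> \<open>The least nonnegative error for which the bound holds once \<open>X n\<close> is
    positive; applying \<open>upper\<close> with \<open>e / 2\<close> shows that it is eventually
    below \<open>e\<close>.\<close>
  define \<epsilon> where "\<epsilon> n = max 0 ((real (f n) - real (c n)) / real (X n) - real \<nu>)" for n
  have Xpos: "\<forall>\<^sub>F n in sequentially. 0 < X n"
    unfolding eventually_sequentially
  proof (intro exI[of _ "k * \<nu> + 1 + k"] allI impI)
    fix n assume "k * \<nu> + 1 + k \<le> n"
    then have n: "k \<le> n - k * \<nu> - 1" by simp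
    have k: "k - 1 = k - 2 + 1" "1 \<le> k - 2" "3 \<le> d - 2" using assms by auto
    have "0 < (n - k * \<nu> - 1) div (k - 2)" using n k unfolding div_greater_zero_iff by arith
    then have "0 < ((n - k * \<nu> - 1) div (k - 2)) ^ (k - 2)" by simp
    also have "\<dots> \<le> X n"
      unfolding X_def k(1) by (rule EX_multi_ge_partite) (use n k in auto)
    finally show "0 < X n" .
  qed
  have "\<epsilon> \<longlonglongrightarrow> 0"
  proof (rule tendstoI)
    fix e :: real assume e: "0 < e"
    then have "0 < e / 2" by simp
    from upper[OF this] Xpos show "\<forall>\<^sub>F n in sequentially. dist (\<epsilon> n) 0 < e"
    proof eventually_elim
      case (elim n)
      then have "(real (f n) - real (c n)) / real (X n) \<le> real \<nu> + e / 2" by (simp add: divide_le_eq)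
      then show ?case using e unfolding \<epsilon>_def dist_real_def by linarith
    qed
  qed
  moreover have "\<forall>\<^sub>F n in sequentially. real (f n) \<le> real (c n) + (real \<nu> + \<epsilon> n) * real (X n)"
    using Xpos
  proof eventually_elim
    case (elim n)
    have "(real (f n) - real (c n)) / real (X n) \<le> real \<nu> + \<epsilon> n" unfolding \<epsilon>_def by linarith
    then show ?case using elim by (simp add: divide_le_eq)
  qed
  ultimately show ?thesis using lower unfolding f_def c_def X_def by blast
qed

end
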